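(* Let $\widetilde{\Delta}=\frac{1-x^2-y^2}{4}\left(\frac{\partial^2}{\partial x^2}+\frac{\partial^2}{\partial y^2}\right)$ on the unit disk, with Dirichlet (zero) boundary conditions on $\overline{\mathbb{D}}$. Then the non-zero eigenvalues of $-\widetilde{\Delta}$ are positive integers. For each positive integer $k$, \[ \ker(\widetilde{\Delta}+k)=\operatorname{span}\bigl\{\varphi^{(p,q)}\,\big|\;pq=k\text{ and }p,q\in\mathbb{Z}_+\bigr\}, \] where $\varphi^{(p,q)}$ are the scattering polynomials and $\mathbb{Z}_+$ is the set of positive integers. In particular, the dimension of $\ker(\widetilde{\Delta}+k)$ is the number of (positive) divisors of $k$.
   Context: $\mathbb{D}=\{z\in\mathbb{C}:|z|<1\}$, $\overline{\mathbb{D}}$ is its closure, and $\mathbb{T}=\{|z|=1\}$. With $\zeta=x+iy$, $\widetilde{\Delta}=(1-\zeta\bar\zeta)\frac{\partial^2}{\partial\zeta\,\partial\bar\zeta}$. An eigenfunction of $-\widetilde\Delta$ with eigenvalue $k\in\mathbb{C}$ and Dirichlet boundary conditions is a non-zero complex-valued $\varphi$ with $-\widetilde{\Delta}\varphi=k\varphi$ in $\mathbb{D}$ and $\varphi=0$ on the boundary circle $\mathbb{T}$; $\ker(\widetilde\Delta+k)$ is understood subject to the same boundary condition, and the span is over $\mathbb{C}$. Scattering polynomials: for integers $p,q\geq 1$, \[ \varphi^{(p,q)}(\zeta)=\frac{(-1)^p}{q\,(p+q-1)!}\,\bigl(1-\zeta\bar\zeta\bigr)\frac{\partial^{p+q}}{\partial\zeta^p\partial\bar\zeta^q}\bigl(1-\zeta\bar\zeta\bigr)^{p+q-1}.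 \] *)

theory Defs
  imports "HOL-Analysis.Analysis" "HOL-Library.Function_Algebras"
begin

definition partial_x :: "(complex \<Rightarrow> complex) \<Rightarrow> complex \<Rightarrow> complex" where
  "partial_x f z = vector_derivative (\<lambda>t. f (z + of_real t)) (at 0)"

definition partial_y :: "(complex \<Rightarrow> complex) \<Rightarrow> complex \<Rightarrow> complex" where
  "partial_y f z = vector_derivative (\<lambda>t. f (z + \<i> * of_real t)) (at 0)"

definition d_zeta :: "(complex \<Rightarrow> complex) \<Rightarrow> complex \<Rightarrow> complex" where
  "d_zeta f z = (partial_x f z - \<i> * partial_y f z) / 2"

definition d_zetabar :: "(complex \<Rightarrow> complex) \<Rightarrow> complex \<Rightarrow> complex" where
  "d_zetabar f z = (partial_x f z + \<i> * partial_y f z) / 2"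

definition laplace_tilde :: "(complex \<Rightarrow> complex) \<Rightarrow> complex \<Rightarrow> complex" where
  "laplace_tilde f z = of_real ((1 - (Re z)\<^sup>2 - (Im z)\<^sup>2) / 4) *
     (partial_x (partial_x f) z + partial_y (partial_y f) z)"

text \<open>Continuous differentiability on an open set in the real sense:
  \<open>differentiable_on\<close> refers to real-linear Frechet derivatives.\<close>

definition C1_on :: "complex set \<Rightarrow> (complex \<Rightarrow> complex) \<Rightarrow> bool" where
  "C1_on S f \<longleftrightarrow> f differentiable_on S \<and>
     continuous_on S (partial_x f) \<and> continuous_on S (partial_y f)"

definition C2_on :: "complex set \<Rightarrow> (complex \<Rightarrow> complex) \<Rightarrow> bool" where
  "C2_on S f \<longleftrightarrow> C1_on S f \<and> C1_on S (partial_x f) \<and> C1_on S (partial_y f)"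

text \<open>A function on the closed unit disk is represented by its extension by zero to the whole
  plane, so that equality of functions is equality on the closed disk and the functions on the
  closed disk form a complex vector space.\<close>

definition on_closed_disk :: "(complex \<Rightarrow> complex) \<Rightarrow> complex \<Rightarrow> complex" where
  "on_closed_disk f z = (if z \<in> cball 0 1 then f z else 0)"

definition dirichlet_functions :: "(complex \<Rightarrow> complex) set" where
  "dirichlet_functions = {f. on_closed_disk f = f \<and> continuous_on (cball 0 1) f \<and>
     C2_on (ball 0 1) f \<and> (\<forall>z\<in>sphere 0 1. f z = 0)}"

definition dirichlet_ker :: "complex \<Rightarrow> (complex \<Rightarrow> complex) set" where
  "dirichlet_ker k =
     {f \<in> dirichlet_functions. \<forall>z\<in>ball 0 1. laplace_tilde f z + k * f z = 0}"

definition dirichlet_eigenfunction :: "complex \<Rightarrow> (complex \<Rightarrow> complex) \<Rightarrow> bool" where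
  "dirichlet_eigenfunction k f \<longleftrightarrow> f \<in> dirichlet_functions \<and> f \<noteq> 0 \<and>
     (\<forall>z\<in>ball 0 1. - laplace_tilde f z = k * f z)"

definition dirichlet_eigenvalue :: "complex \<Rightarrow> bool" where
  "dirichlet_eigenvalue k \<longleftrightarrow> (\<exists>f. dirichlet_eigenfunction k f)"

definition scattering_poly :: "nat \<Rightarrow> nat \<Rightarrow> complex \<Rightarrow> complex" where
  "scattering_poly p q \<zeta> = (-1) ^ p / (of_nat q * fact (p + q - 1)) * (1 - \<zeta> * cnj \<zeta>) *
     (d_zeta ^^ p) ((d_zetabar ^^ q) (\<lambda>w. (1 - w * cnj w) ^ (p + q - 1))) \<zeta>"

text \<open>The complex vector space of functions on the plane with pointwise operations, giving
  \<open>cfun.span\<close> and \<open>cfun.dim\<close> over the complex numbers.\<close>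

definition cfun_scale :: "complex \<Rightarrow> (complex \<Rightarrow> complex) \<Rightarrow> complex \<Rightarrow> complex" where
  "cfun_scale c f = (\<lambda>z. c * f z)"

interpretation cfun: vector_space cfun_scale
  by unfold_locales (auto simp: cfun_scale_def fun_eq_iff algebra_simps)

end

theory Submission
  imports Defs
begin

text \<open>
The operator is formally self-adjoint for the inner product with weight \<open>1 / (1 - z * cnj z)\<close>, and the
scattering polynomials form an orthogonal system of eigenfunctions that is complete. Completeness is
what makes the list of eigenvalues and eigenfunctions exhaustive.

Each scattering polynomial is \<open>1 - z * cnj z\<close> times a polynomial \<open>scat_core p q\<close> whose coefficients
satisfy a two-term recurrence; that recurrence is the eigenvalue equation with eigenvalue \<open>p * q\<close>
(\<open>scattering_poly_in_ker\<close>). The factor \<open>1 - z * cnj z\<close> cancels the weight, so orthogonality to a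
scattering polynomial in the weighted sense is orthogonality to \<open>scat_core p q\<close> for plain area measure.
The top monomials of the \<open>scat_core p q\<close> run through all monomials in \<open>z\<close> and \<open>cnj z\<close>, hence a
continuous function orthogonal to all of them has vanishing moments and is \<open>0\<close> by the theorem of Stone
and Weierstrass (\<open>scat_core_complete\<close>).

An eigenfunction with eigenvalue \<open>k\<close> is orthogonal to every \<open>scat_core p q\<close> with \<open>p * q\<close> different
from \<open>k\<close> (\<open>eigenfunction_scat_core_orthogonal\<close>). This is Green's formula; the difficulty is that an
eigenfunction is merely continuous at the boundary circle, so its normal derivative there may be
unbounded. Passing to one Fourier mode reduces the matter to an ordinary differential equation
(\<open>fourier_mode_ode\<close>): the boundary term has a limit, and a non-zero limit would make the mode grow
logarithmically near the boundary (\<open>no_logarithmic_growth\<close>).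

Consequently an eigenfunction equals its projection to the finitely many scattering polynomials with
\<open>p * q = k\<close> (\<open>dirichlet_ker_expansion\<close>). In particular there is none unless \<open>k\<close> is a positive integer.
These scattering polynomials are orthogonal to each other, since equal eigenvalues \<open>p * q\<close> force
different Fourier modes \<open>q - p\<close>, and non-zero, so they are a basis indexed by the divisors of \<open>k\<close>.
\<close>

section \<open>Real partial derivatives\<close>

lemma has_derivative_partials:
  assumes "(f has_derivative f') (at z)"
  shows "partial_x f z = f' 1" and "partial_y f z = f' \<i>"
proof -
  have *: "((\<lambda>t::real. f (z + v * of_real t)) has_vector_derivative f' v) (at 0)" for v
  proof -
    have 1: "((\<lambda>t::real. z + v * of_real t) has_derivative (\<lambda>t. v * of_real t)) (at 0)"
      by (auto intro!: derivative_eq_intros)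
    have "((\<lambda>t::real. f (z + v * of_real t)) has_derivative (\<lambda>t. f' (v * of_real t))) (at 0)"
      using has_derivative_compose[OF 1, of f f'] assms by simp
    moreover have "f' (v * of_real t) = t *\<^sub>R f' v" for t
      using linear_scale[OF has_derivative_linear[OF assms], of t v]
      by (simp add: scaleR_conv_of_real mult.commute)
    ultimately show ?thesis by (simp add: has_vector_derivative_def)
  qed
  from *[of 1] show "partial_x f z = f' 1"
    by (auto simp: partial_x_def intro: vector_derivative_at)
  from *[of \<i>] show "partial_y f z = f' \<i>"
    by (auto simp: partial_y_def intro: vector_derivative_at)
qed

lemma has_derivative_by_partials:
  assumes "f differentiable at z"
  shows "(f has_derivative (\<lambda>h. Re h *\<^sub>R partial_x f z + Im h *\<^sub>R partial_y f z)) (at z)"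
proof -
  obtain f' where f': "(f has_derivative f') (at z)"
    using assms by (auto simp: differentiable_def)
  interpret linear f' by (rule has_derivative_linear[OF f'])
  have "f' h = Re h *\<^sub>R partial_x f z + Im h *\<^sub>R partial_y f z" for h
  proof -
    have "f' h = f' (Re h *\<^sub>R 1 + Im h *\<^sub>R \<i>)"
      by (rule arg_cong[where f=f']) (simp add: complex_eq_iff)
    then show ?thesis by (simp add: add scale has_derivative_partials[OF f'])
  qed
  then show ?thesis using f' by presburger
qed

lemma partials_lincomb:
  assumes "f differentiable at z" and "g differentiable at z"
  shows "partial_x (\<lambda>w. c * f w + g w) z = c * partial_x f z + partial_x g z"
    and "partial_y (\<lambda>w. c * f w + g w) z = c * partial_y f z + partial_y g z"
proof -
  obtain f' g' where f': "(f has_derivative f') (at z)" and g': "(g has_derivative g') (at z)"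
    using assms by (auto simp: differentiable_def)
  have "((\<lambda>w. c * f w + g w) has_derivative (\<lambda>h. c * f' h + g' h)) (at z)"
    by (auto intro!: derivative_eq_intros f' g')
  note * = has_derivative_partials[OF this] has_derivative_partials[OF f']
    has_derivative_partials[OF g']
  show "partial_x (\<lambda>w. c * f w + g w) z = c * partial_x f z + partial_x g z"
    and "partial_y (\<lambda>w. c * f w + g w) z = c * partial_y f z + partial_y g z"
    by (simp_all add: *)
qed

text \<open>A partial derivative depends only on the germ of the function. This lets a polynomial be replaced by
its truncation to the closed disk, and lets second derivatives be computed from first derivatives
that are known on an open set only.\<close>

lemma partials_cong_open:
  assumes "open S" "z \<in> S" and eq: "\<And>w. w \<in> S \<Longrightarrow> f w = g w"
  shows "partial_x f z = partial_x g z" and "partial_y f z = partial_y g z"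
proof -
  have *: "vector_derivative (\<lambda>t::real. f (z + v * of_real t)) (at 0) =
        vector_derivative (\<lambda>t::real. g (z + v * of_real t)) (at 0)" for v
  proof (rule vector_derivative_cong_eq)
    have "((\<lambda>t::real. z + v * of_real t) \<longlongrightarrow> z + v * of_real 0) (nhds 0)"
      by (intro tendsto_intros filterlim_ident)
    then have "\<forall>\<^sub>F t::real in nhds 0. z + v * of_real t \<in> S"
      using assms(1,2) by (auto simp: tendsto_def)
    then show "\<forall>\<^sub>F t::real in nhds 0. t \<in> UNIV \<longrightarrow> f (z + v * of_real t) = g (z + v * of_real t)"
      by eventually_elim (simp add: eq)
  qed auto
  from *[of 1] show "partial_x f z = partial_x g z" by (simp add: partial_x_def)
  from *[of \<i>] show "partial_y f z = partial_y g z" by (simp add: partial_y_def)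
qed

lemma C1_on_differentiable:
  assumes "C1_on S f" "open S" "z \<in> S"
  shows "f differentiable at z"
  using assms by (simp add: C1_on_def differentiable_on_eq_differentiable_at)

lemma C1_on_cong:
  assumes "C1_on S f" "open S" and eq: "\<And>w. w \<in> S \<Longrightarrow> f w = g w"
  shows "C1_on S g"
  unfolding C1_on_def
proof (intro conjI)
  show "g differentiable_on S"
    unfolding differentiable_on_def
  proof
    fix z assume z: "z \<in> S"
    then have "f differentiable at z within S"
      using assms(1) by (auto simp: C1_on_def differentiable_on_def)
    then show "g differentiable at z within S"
      by (rule differentiable_transform_within[where d=1]) (use z eq in auto)
  qed
  show "continuous_on S (partial_x g)"
    using assms(1) partials_cong_open(1)[OF \<open>open S\<close> _ eq]
    by (auto simp: C1_on_def cong: continuous_on_cong)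
  show "continuous_on S (partial_y g)"
    using assms(1) partials_cong_open(2)[OF \<open>open S\<close> _ eq]
    by (auto simp: C1_on_def cong: continuous_on_cong)
qed

lemma C2_on_cong:
  assumes "C2_on S f" "open S" and eq: "\<And>w. w \<in> S \<Longrightarrow> f w = g w"
  shows "C2_on S g"
  using assms(1) C1_on_cong[OF _ \<open>open S\<close> eq, of "\<lambda>w. w"]
    C1_on_cong[OF _ \<open>open S\<close>, of "partial_x f" "partial_x g"]
    C1_on_cong[OF _ \<open>open S\<close>, of "partial_y f" "partial_y g"]
    partials_cong_open[OF \<open>open S\<close> _ eq, of _ "\<lambda>w. w"]
  unfolding C2_on_def by blast

lemma laplace_tilde_cong:
  assumes "open S" "z \<in> S" and eq: "\<And>w. w \<in> S \<Longrightarrow> f w = g w"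
  shows "laplace_tilde f z = laplace_tilde g z"
  using partials_cong_open(1)[OF assms(1,2) partials_cong_open(1)[OF assms(1) _ eq]]
    partials_cong_open(2)[OF assms(1,2) partials_cong_open(2)[OF assms(1) _ eq]]
  by (simp add: laplace_tilde_def)

lemma C1_on_lincomb:
  assumes "C1_on S f" "C1_on S g" "open S"
  shows "C1_on S (\<lambda>w. c * f w + g w)"
proof -
  note d = C1_on_differentiable[OF assms(1,3)] C1_on_differentiable[OF assms(2,3)]
  have "(\<lambda>w. c * f w + g w) differentiable_on S"
    using assms by (auto simp: C1_on_def differentiable_on_def intro!: derivative_intros)
  moreover have "continuous_on S (\<lambda>z. c * partial_x f z + partial_x g z)"
    "continuous_on S (\<lambda>z. c * partial_y f z + partial_y g z)"
    using assms by (auto simp: C1_on_def intro!: continuous_intros)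
  ultimately show ?thesis
    unfolding C1_on_def using partials_lincomb[OF d] by (auto cong: continuous_on_cong)
qed

lemma C2_on_lincomb:
  assumes "C2_on S f" "C2_on S g" "open S"
  shows "C2_on S (\<lambda>w. c * f w + g w)"
proof -
  have 1: "C1_on S f" "C1_on S g" using assms by (auto simp: C2_on_def)
  note d = C1_on_differentiable[OF 1(1) assms(3)] C1_on_differentiable[OF 1(2) assms(3)]
  show ?thesis
    unfolding C2_on_def
    using C1_on_lincomb[OF 1 assms(3)]
      C1_on_cong[OF C1_on_lincomb[of S "partial_x f" "partial_x g" c] assms(3)
        partials_lincomb(1)[OF d, symmetric]]
      C1_on_cong[OF C1_on_lincomb[of S "partial_y f" "partial_y g" c] assms(3)
        partials_lincomb(2)[OF d, symmetric]] assms
    unfolding C2_on_def by blast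
qed

lemma laplace_tilde_lincomb:
  assumes "C2_on S f" "C2_on S g" "open S" "z \<in> S"
  shows "laplace_tilde (\<lambda>w. c * f w + g w) z = c * laplace_tilde f z + laplace_tilde g z"
proof -
  have C: "C1_on S f" "C1_on S g" "C1_on S (partial_x f)" "C1_on S (partial_x g)"
    "C1_on S (partial_y f)" "C1_on S (partial_y g)"
    using assms by (auto simp: C2_on_def)
  note d = C1_on_differentiable[OF C(1) assms(3)] C1_on_differentiable[OF C(2) assms(3)]
  note dz = C[THEN C1_on_differentiable, OF assms(3,4)]
  have "partial_x (partial_x (\<lambda>w. c * f w + g w)) z = c * partial_x (partial_x f) z + partial_x (partial_x g) z"
    using partials_cong_open(1)[OF assms(3,4) partials_lincomb(1)[OF d]] partials_lincomb(1)[OF dz(3,4)]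
    by simp
  moreover have "partial_y (partial_y (\<lambda>w. c * f w + g w)) z = c * partial_y (partial_y f) z + partial_y (partial_y g) z"
    using partials_cong_open(2)[OF assms(3,4) partials_lincomb(2)[OF d]] partials_lincomb(2)[OF dz(5,6)]
    by simp
  ultimately show ?thesis
    by (simp only: laplace_tilde_def distrib_left mult.left_commute add_ac)
qed

lemma partials_by_wirtinger:
  "partial_x f = (\<lambda>z. 1 * d_zeta f z + d_zetabar f z)"
  "partial_y f = (\<lambda>z. \<i> * d_zeta f z + - \<i> * d_zetabar f z)"
  by (auto simp: fun_eq_iff d_zeta_def d_zetabar_def field_simps)

text \<open>The Laplacian is \<open>4\<close> times the mixed Wirtinger derivative. Equality of the two mixed
derivatives is a hypothesis since it can be read off directly for the polynomials below.\<close>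

lemma laplace_tilde_wirtinger:
  assumes "d_zeta f differentiable at z" "d_zetabar f differentiable at z"
    and "d_zetabar (d_zeta f) z = d_zeta (d_zetabar f) z"
  shows "laplace_tilde f z = (1 - z * cnj z) * d_zeta (d_zetabar f) z"
proof -
  have *: "(\<lambda>w. - \<i> * d_zetabar f w) differentiable at z"
    using assms(2) by (auto intro!: derivative_intros)
  have m: "partial_y (\<lambda>w. - \<i> * d_zetabar f w) z = - \<i> * partial_y (d_zetabar f) z"
    using partials_lincomb(2)[OF assms(2), of "\<lambda>_. 0" "-\<i>"]
    by (simp add: partial_y_def)
  have "partial_x (partial_x f) z + partial_y (partial_y f) z =
     partial_x (d_zeta f) z + partial_x (d_zetabar f) z
     + \<i> * partial_y (d_zeta f) z - \<i> * partial_y (d_zetabar f) z"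
    using partials_lincomb(1)[OF assms(1,2), of 1] partials_lincomb(2)[OF assms(1) *, of \<i>] m
    by (subst (2) partials_by_wirtinger(1), subst (2) partials_by_wirtinger(2)) simp
  also have "\<dots> = 2 * d_zetabar (d_zeta f) z + 2 * d_zeta (d_zetabar f) z"
    by (simp add: d_zeta_def[of "d_zetabar f"] d_zetabar_def[of "d_zeta f"] field_simps)
  finally have "partial_x (partial_x f) z + partial_y (partial_y f) z = 4 * d_zeta (d_zetabar f) z"
    using assms(3) by simp
  moreover have "complex_of_real ((1 - (Re z)\<^sup>2 - (Im z)\<^sup>2) / 4) = (1 - z * cnj z) / 4"
    by (simp add: complex_eq_iff power2_eq_square)
  ultimately show ?thesis
    unfolding laplace_tilde_def by (simp only: times_divide_eq_left times_divide_eq_right) simp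
qed

section \<open>Polynomials in \<open>z\<close> and its conjugate\<close>

text \<open>The exponents are given by functions with truncated subtraction in mind: lowering the exponent \<open>0\<close>
does no harm because the Wirtinger derivative multiplies that term by \<open>0\<close>. The form is therefore
closed under both Wirtinger derivatives, with no case distinctions.\<close>

definition zpoly :: "'i set \<Rightarrow> ('i \<Rightarrow> complex) \<Rightarrow> ('i \<Rightarrow> nat) \<Rightarrow> ('i \<Rightarrow> nat) \<Rightarrow> complex \<Rightarrow> complex" where
  "zpoly A c a b = (\<lambda>w. \<Sum>m\<in>A. c m * w ^ a m * cnj w ^ b m)"

lemma zpoly_has_derivative:
  "(zpoly A c a b has_derivative
     (\<lambda>h. zpoly A (\<lambda>m. c m * of_nat (a m)) (\<lambda>m. a m - 1) b z * h
        + zpoly A (\<lambda>m. c m * of_nat (b m)) a (\<lambda>m. b m - 1) z * cnj h)) (at z)"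
proof -
  have "((\<lambda>w. c m * w ^ a m * cnj w ^ b m) has_derivative
      (\<lambda>h. c m * of_nat (a m) * z ^ (a m - 1) * cnj z ^ b m * h
         + c m * of_nat (b m) * z ^ a m * cnj z ^ (b m - 1) * cnj h)) (at z)" for m
    by (rule has_derivative_eq_rhs, (rule has_derivative_mult has_derivative_power
          has_derivative_ident has_derivative_const has_derivative_cnj)+)
       (simp add: fun_eq_iff algebra_simps)
  then show ?thesis
    unfolding zpoly_def sum_distrib_right sum.distrib[symmetric] by (intro has_derivative_sum)
qed

lemma d_zeta_zpoly:
  "d_zeta (zpoly A c a b) = zpoly A (\<lambda>m. c m * of_nat (a m)) (\<lambda>m. a m - 1) b"
  and d_zetabar_zpoly:
  "d_zetabar (zpoly A c a b) = zpoly A (\<lambda>m. c m * of_nat (b m)) a (\<lambda>m. b m - 1)"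
  by (simp_all add: fun_eq_iff d_zeta_def d_zetabar_def algebra_simps
      has_derivative_partials[OF zpoly_has_derivative])

lemma zpoly_differentiable [simp]: "zpoly A c a b differentiable (at z within S)"
  using has_derivative_at_withinI[OF zpoly_has_derivative] unfolding differentiable_def by blast

lemma continuous_on_zpoly: "continuous_on S (zpoly A c a b)"
  by (intro differentiable_imp_continuous_on) (simp add: differentiable_on_def)

lemma C1_on_zpoly: "C1_on S (zpoly A c a b)"
  unfolding C1_on_def partials_by_wirtinger
  by (auto simp: d_zeta_zpoly d_zetabar_zpoly differentiable_on_def
      intro!: continuous_intros continuous_on_zpoly)

lemma C2_on_zpoly: "open S \<Longrightarrow> C2_on S (zpoly A c a b)"
proof -
  assume S: "open S"
  have "C1_on S (\<lambda>w. d * zpoly A c a b w)" for d A c a b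
    using C1_on_lincomb[OF C1_on_zpoly C1_on_zpoly S, of d A c a b "{}" c a b]
    by (simp add: zpoly_def)
  then show ?thesis
    unfolding C2_on_def partials_by_wirtinger[of "zpoly A c a b"] d_zeta_zpoly d_zetabar_zpoly
    by (intro conjI C1_on_zpoly C1_on_lincomb S)
qed

lemma laplace_tilde_zpoly:
  "laplace_tilde (zpoly A c a b) z = (1 - z * cnj z) *
     zpoly A (\<lambda>m. c m * of_nat (a m) * of_nat (b m)) (\<lambda>m. a m - 1) (\<lambda>m. b m - 1) z"
  by (subst laplace_tilde_wirtinger) (auto simp: d_zeta_zpoly d_zetabar_zpoly mult.commute mult.left_commute)

text \<open>The falling factorial \<open>m (m - 1) \<dots> (m - p + 1)\<close>. Truncated subtraction makes it vanish for
\<open>m < p\<close>, which is the factor produced by differentiating \<open>z ^ m\<close> more than \<open>m\<close> times.\<close>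

definition falling :: "nat \<Rightarrow> nat \<Rightarrow> nat" where
  "falling m p = (\<Prod>l<p. m - l)"

lemma falling_eq_0: "m < p \<Longrightarrow> falling m p = 0"
  by (auto simp: falling_def)

text \<open>The division-free form of \<open>falling (m + 1) p = (m + 1) / (m + 1 - p) * falling m p\<close>, which is what
the quotient of two consecutive coefficients of a scattering polynomial requires.\<close>

lemma falling_Suc_left: "p \<le> m \<Longrightarrow> falling (Suc m) p * (Suc m - p) = Suc m * falling m p"
proof (induction p)
  case (Suc p)
  then have IH: "falling (Suc m) p * (Suc m - p) = Suc m * falling m p" by simp
  have "falling (Suc m) (Suc p) * (Suc m - Suc p) = falling (Suc m) p * (Suc m - p) * (m - p)"
    by (simp add: falling_def)
  also have "\<dots> = Suc m * falling m (Suc p)"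
    unfolding IH by (simp only: falling_def prod.lessThan_Suc mult.assoc)
  finally show ?case .
qed (simp add: falling_def)

lemma wirtinger_iterate_zpoly:
  "(d_zeta ^^ p) (zpoly A c a b) = zpoly A (\<lambda>m. c m * of_nat (falling (a m) p)) (\<lambda>m. a m - p) b"
  "(d_zetabar ^^ p) (zpoly A c a b) = zpoly A (\<lambda>m. c m * of_nat (falling (b m) p)) a (\<lambda>m. b m - p)"
  by (induction p) (auto simp: falling_def d_zeta_zpoly d_zetabar_zpoly mult.assoc)

section \<open>The scattering polynomials\<close>

text \<open>The coefficients obtained by expanding \<open>(1 - z * cnj z) ^ (p + q - 1)\<close> with the binomial theorem and
differentiating term by term. The function \<open>scat_core\<close> is the scattering polynomial without its
factor \<open>1 - z * cnj z\<close>; that factor cancels the weight of the operator, so \<open>scat_core\<close> rather than the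
scattering polynomial itself is what eigenfunctions are integrated against.\<close>

definition scat_coeff :: "nat \<Rightarrow> nat \<Rightarrow> nat \<Rightarrow> real" where
  "scat_coeff p q m = (-1) ^ (p + m) / (of_nat q * fact (p + q - 1)) *
     of_nat ((p + q - 1) choose m) * of_nat (falling m p) * of_nat (falling m q)"

definition scat_core :: "nat \<Rightarrow> nat \<Rightarrow> complex \<Rightarrow> complex" where
  "scat_core p q = zpoly {..p + q - 1} (\<lambda>m. of_real (scat_coeff p q m)) (\<lambda>m. m - p) (\<lambda>m. m - q)"

lemma scattering_poly_factor: "scattering_poly p q z = (1 - z * cnj z) * scat_core p q z"
proof -
  let ?N = "p + q - 1"
  have "(\<lambda>w. (1 - w * cnj w) ^ ?N) =
      zpoly {..?N} (\<lambda>m. of_nat (?N choose m) * (-1) ^ m) (\<lambda>m. m) (\<lambda>m. m)"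
  proof
    fix w
    have "(1 - w * cnj w) ^ ?N = (- (w * cnj w) + 1) ^ ?N" by simp
    also have "\<dots> = (\<Sum>m\<le>?N. of_nat (?N choose m) * (- (w * cnj w)) ^ m)"
      by (subst binomial_ring) simp
    also have "\<dots> = zpoly {..?N} (\<lambda>m. of_nat (?N choose m) * (-1) ^ m) (\<lambda>m. m) (\<lambda>m. m) w"
      unfolding zpoly_def
      by (intro sum.cong refl) (simp add: power_minus[of "w * cnj w"] power_mult_distrib)
    finally show "(1 - w * cnj w) ^ ?N = \<dots>" .
  qed
  then show ?thesis
    unfolding scattering_poly_def scat_core_def
    by (simp add: wirtinger_iterate_zpoly)
       (simp add: zpoly_def scat_coeff_def sum_distrib_left power_add algebra_simps
         sum_divide_distrib diff_divide_distrib)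
qed

lemma scat_coeff_eq_0: "m < p \<or> m < q \<Longrightarrow> scat_coeff p q m = 0"
  by (auto simp: scat_coeff_def falling_eq_0)

text \<open>The top monomial of \<open>scat_core p q\<close> is \<open>z ^ (q - 1) * cnj z ^ (p - 1)\<close>, so every monomial occurs as the
top one for exactly one pair \<open>(p, q)\<close>. Completeness rests on this.\<close>

lemma scat_coeff_top: "p > 0 \<Longrightarrow> q > 0 \<Longrightarrow> scat_coeff p q (p + q - 1) \<noteq> 0"
  by (auto simp: scat_coeff_def falling_def)

text \<open>With \<open>i = m + 1 - p\<close> and \<open>j = m + 1 - q\<close> this is the eigenvalue equation compared at one monomial:
the decisive identity is \<open>p * q - i * j = (m + 1) * (p + q - 1 - m)\<close>.\<close>

lemma scat_coeff_rec:
  assumes "p > 0" "q > 0"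
  shows "scat_coeff p q (Suc m) * of_nat (Suc m - p) * of_nat (Suc m - q) =
    scat_coeff p q m * (of_nat (Suc m - p) * of_nat (Suc m - q) - of_nat p * of_nat q)"
proof (cases "p \<le> m \<and> q \<le> m")
  case False
  then have "Suc m - p = 0 \<or> Suc m - q = 0" and "scat_coeff p q m = 0"
    by (auto simp: scat_coeff_eq_0)
  then show ?thesis by (metis mult_zero_left mult_zero_right mult.assoc of_nat_0)
next
  case True
  define N where "N = p + q - 1"
  define K :: real where "K = (-1) ^ (p + m) / (of_nat q * fact N)"
  have 1: "real (falling (Suc m) p) * real (Suc m - p) = real (Suc m) * real (falling m p)"
    "real (falling (Suc m) q) * real (Suc m - q) = real (Suc m) * real (falling m q)"
    using falling_Suc_left[of p m] falling_Suc_left[of q m] True by (metis of_nat_mult)+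
  have 2: "real (N choose Suc m) * real (Suc m) = real (N choose m) * (real N - real m)"
  proof (cases "m \<le> N")
    case True
    have "Suc m * (N choose Suc m) = (N - m) * (N choose m)"
      by (simp only: binomial_absorption binomial_absorb_comp)
    then have "real (Suc m) * real (N choose Suc m) = real (N - m) * real (N choose m)"
      by (metis of_nat_mult)
    then show ?thesis using True by (simp add: of_nat_diff mult.commute)
  qed (simp add: binomial_eq_0)
  have 3: "real (Suc m) * (real N - real m) = real p * real q - real (Suc m - p) * real (Suc m - q)"
    using True assms by (simp add: N_def of_nat_diff algebra_simps)
  have "scat_coeff p q (Suc m) * of_nat (Suc m - p) * of_nat (Suc m - q) =
    - K * real (N choose Suc m) * (real (falling (Suc m) p) * real (Suc m - p))
      * (real (falling (Suc m) q) * real (Suc m - q))"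
    by (simp add: scat_coeff_def K_def N_def)
  also have "\<dots> = - K * (real (N choose Suc m) * real (Suc m)) * real (Suc m) * real (falling m p) * real (falling m q)"
    unfolding 1 by simp
  also have "\<dots> = - (K * real (N choose m) * real (falling m p) * real (falling m q)) * (real (Suc m) * (real N - real m))"
    unfolding 2 by simp
  also have "\<dots> = scat_coeff p q m * (of_nat (Suc m - p) * of_nat (Suc m - q) - of_nat p * of_nat q)"
    unfolding 3 by (simp add: scat_coeff_def K_def N_def algebra_simps diff_divide_distrib)
  finally show ?thesis .
qed

text \<open>Since the operator carries the weight \<open>1 - z * cnj z\<close>, the claim is that the mixed Wirtinger derivative
of \<open>(1 - z * cnj z) * scat_core p q z\<close> is \<open>- p * q\<close> times \<open>scat_core p q z\<close>. Multiplication by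
\<open>1 - z * cnj z\<close> gives the difference of two polynomials whose exponents differ by one; after shifting
the summation index in one of them the claim is the coefficient recurrence.\<close>

lemma scat_core_pde:
  assumes "p > 0" "q > 0"
  shows "laplace_tilde (\<lambda>z. (1 - z * cnj z) * scat_core p q z) z
    = - of_nat (p * q) * ((1 - z * cnj z) * scat_core p q z)"
proof -
  define N where "N = p + q - 1"
  define c where "c m = complex_of_real (scat_coeff p q m)" for m
  define t where "t m = c m * of_nat (m - p) * of_nat (m - q) * z ^ (m - p - 1) * cnj z ^ (m - q - 1)" for m
  let ?G = "zpoly {..N} c (\<lambda>m. m - p) (\<lambda>m. m - q)"
  let ?H = "zpoly {..N} c (\<lambda>m. Suc (m - p)) (\<lambda>m. Suc (m - q))"
  have G: "scat_core p q = ?G" by (simp add: scat_core_def N_def c_def[abs_def])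
  have "(\<lambda>z. (1 - z * cnj z) * scat_core p q z) = (\<lambda>z. - 1 * ?H z + ?G z)"
    unfolding G by (simp add: fun_eq_iff zpoly_def algebra_simps sum_distrib_left sum_negf sum_subtractf)
  then have "laplace_tilde (\<lambda>z. (1 - z * cnj z) * scat_core p q z) z
      = - 1 * laplace_tilde ?H z + laplace_tilde ?G z"
    by (simp only: laplace_tilde_lincomb[OF C2_on_zpoly[OF open_UNIV] C2_on_zpoly[OF open_UNIV] open_UNIV UNIV_I])
  also have "\<dots> = (1 - z * cnj z) * ((\<Sum>m\<le>N. t m) -
      (\<Sum>m\<le>N. c m * of_nat (Suc (m - p)) * of_nat (Suc (m - q)) * z ^ (m - p) * cnj z ^ (m - q)))"
    unfolding laplace_tilde_zpoly by (simp add: zpoly_def t_def algebra_simps)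
  also have "(\<Sum>m\<le>N. t m) = (\<Sum>m\<le>N. t (Suc m))"
  proof -
    \<comment> \<open>Both boundary terms of the index shift vanish: the first by the factor \<open>0 - p\<close>, the last by the
      binomial coefficient.\<close>
    have "t 0 = 0" using assms by (simp add: t_def)
    moreover have "t (Suc N) = 0" by (simp add: t_def c_def scat_coeff_def N_def binomial_eq_0)
    ultimately show ?thesis using sum.atMost_Suc_shift[of t N] by simp
  qed
  also have "(\<Sum>m\<le>N. t (Suc m)) -
      (\<Sum>m\<le>N. c m * of_nat (Suc (m - p)) * of_nat (Suc (m - q)) * z ^ (m - p) * cnj z ^ (m - q))
      = (\<Sum>m\<le>N. - of_nat (p * q) * (c m * z ^ (m - p) * cnj z ^ (m - q)))"
    unfolding sum_subtractf[symmetric]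
  proof (rule sum.cong[OF refl])
    fix m
    have "c (Suc m) * of_nat (Suc m - p) * of_nat (Suc m - q)
        = c m * (of_nat (Suc m - p) * of_nat (Suc m - q) - of_nat p * of_nat q)"
      unfolding c_def using arg_cong[OF scat_coeff_rec[OF assms, of m], of complex_of_real] by simp
    then have 1: "t (Suc m) = c m * (of_nat (Suc m - p) * of_nat (Suc m - q) - of_nat p * of_nat q)
        * z ^ (m - p) * cnj z ^ (m - q)"
      by (simp add: t_def)
    show "t (Suc m) - c m * of_nat (Suc (m - p)) * of_nat (Suc (m - q)) * z ^ (m - p) * cnj z ^ (m - q)
      = - of_nat (p * q) * (c m * z ^ (m - p) * cnj z ^ (m - q))"
    proof (cases "p \<le> m \<and> q \<le> m")
      case True
      then have e: "Suc m - p = Suc (m - p)" "Suc m - q = Suc (m - q)" by auto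
      show ?thesis unfolding 1 e of_nat_mult by algebra
    next
      case False
      then have "c m = 0" by (auto simp: c_def scat_coeff_eq_0)
      then show ?thesis unfolding 1 by simp
    qed
  qed
  also have "\<dots> = - of_nat (p * q) * ?G z"
    unfolding zpoly_def by (rule sum_distrib_left[symmetric])
  finally show ?thesis unfolding G by (simp add: mult.left_commute)
qed

lemma continuous_on_scat_core: "continuous_on S (scat_core p q)"
  unfolding scat_core_def by (rule continuous_on_zpoly)

lemma on_closed_disk_scattering_poly:
  "z \<in> cball 0 1 \<Longrightarrow> on_closed_disk (scattering_poly p q) z = (1 - z * cnj z) * scat_core p q z"
  by (simp add: on_closed_disk_def scattering_poly_factor)

lemma continuous_on_scattering_poly:
  "continuous_on (cball 0 1) (on_closed_disk (scattering_poly p q))"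
proof -
  have "continuous_on (cball 0 1) (\<lambda>z. (1 - z * cnj z) * scat_core p q z)"
    by (intro continuous_intros continuous_on_scat_core)
  then show ?thesis
    by (rule continuous_on_eq) (simp add: on_closed_disk_scattering_poly)
qed

lemma scattering_poly_in_ker:
  assumes "p > 0" "q > 0"
  shows "on_closed_disk (scattering_poly p q) \<in> dirichlet_ker (of_nat (p * q))"
proof -
  let ?f = "on_closed_disk (scattering_poly p q)" and ?g = "\<lambda>z. (1 - z * cnj z) * scat_core p q z"
  have eq: "?g z = ?f z" if "z \<in> ball 0 1" for z
    using that by (simp add: on_closed_disk_scattering_poly)
  have g: "?g = (\<lambda>z. - 1 * zpoly {..p + q - 1} (\<lambda>m. of_real (scat_coeff p q m)) (\<lambda>m. Suc (m - p))
      (\<lambda>m. Suc (m - q)) z + scat_core p q z)"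
    by (simp add: fun_eq_iff scat_core_def zpoly_def algebra_simps sum_distrib_left sum_negf sum_subtractf)
  have "C2_on (ball 0 1) ?g"
    unfolding g by (intro C2_on_lincomb) (auto simp: scat_core_def intro: C2_on_zpoly)
  then have "C2_on (ball 0 1) ?f"
    by (rule C2_on_cong[OF _ _ eq]) auto
  moreover have "laplace_tilde ?f z + of_nat (p * q) * ?f z = 0" if z: "z \<in> ball 0 1" for z
    using laplace_tilde_cong[OF _ z eq] scat_core_pde[OF assms, of z] eq[OF z]
    by simp
  moreover have "?f z = 0" if "z \<in> sphere 0 1" for z
  proof -
    have "z * cnj z = 1" using that by (simp add: complex_norm_square[symmetric])
    then show ?thesis using that by (simp add: on_closed_disk_scattering_poly)
  qed
  moreover have "on_closed_disk ?f = ?f" by (auto simp: on_closed_disk_def)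
  ultimately show ?thesis
    by (simp add: dirichlet_ker_def dirichlet_functions_def continuous_on_scattering_poly)
qed

section \<open>Integration over the disk in polar coordinates\<close>

text \<open>The area integral over the unit disk, written in polar coordinates from the start because the radial
and the angular variable play different roles in the proof.\<close>

definition disk_integral :: "(complex \<Rightarrow> complex) \<Rightarrow> complex" where
  "disk_integral F = integral {0..1} (\<lambda>r. of_real r * integral {0..2 * pi} (\<lambda>t. F (rcis r t)))"

lemma continuous_on_rcis [continuous_intros]:
  assumes "continuous_on S f" "continuous_on S g"
  shows "continuous_on S (\<lambda>x. rcis (f x) (g x))"
  unfolding rcis_def cis_conv_exp using assms by (intro continuous_intros)

lemma rcis_in_cball: "0 \<le> r \<Longrightarrow> r \<le> 1 \<Longrightarrow> rcis r t \<in> cball 0 1"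
  by simp

lemma circle_continuous:
  fixes F :: "complex \<Rightarrow> 'b::real_normed_vector"
  assumes "continuous_on (cball 0 1) F" "0 \<le> r" "r \<le> 1"
  shows "continuous_on S (\<lambda>t. F (rcis r t))"
  by (rule continuous_on_compose2[OF assms(1)]) (use assms in \<open>auto intro!: continuous_intros\<close>)

lemma circle_integral_continuous:
  fixes F :: "complex \<Rightarrow> 'b::banach"
  assumes "continuous_on (cball 0 1) F"
  shows "continuous_on {0..1} (\<lambda>r. integral {0..2 * pi} (\<lambda>t. F (rcis r t)))"
proof -
  have "continuous_on ({0..1} \<times> cbox 0 (2 * pi)) (\<lambda>(r, t). F (rcis r t))"
    unfolding case_prod_unfold
    by (rule continuous_on_compose2[OF assms])
       (auto intro!: continuous_intros)
  then show ?thesis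
    using integral_continuous_on_param[of "{0..1}" 0 "2 * pi" "\<lambda>r t. F (rcis r t)"] by simp
qed

lemma disk_integral_integrable:
  fixes F :: "complex \<Rightarrow> complex"
  assumes "continuous_on (cball 0 1) F"
  shows "(\<lambda>r. of_real r * integral {0..2 * pi} (\<lambda>t. F (rcis r t))) integrable_on {0..1}"
  by (intro integrable_continuous_interval continuous_intros circle_integral_continuous assms)

lemma disk_integral_lincomb:
  assumes F: "continuous_on (cball 0 1) F" and H: "continuous_on (cball 0 1) H"
  shows "disk_integral (\<lambda>z. c * F z + H z) = c * disk_integral F + disk_integral H"
proof -
  have "integral {0..2 * pi} (\<lambda>t. c * F (rcis r t) + H (rcis r t)) =
     c * integral {0..2 * pi} (\<lambda>t. F (rcis r t)) + integral {0..2 * pi} (\<lambda>t. H (rcis r t))"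
    if "r \<in> {0..1}" for r
    using that
    by (subst integral_add)
       (auto intro!: integrable_continuous_interval continuous_intros circle_continuous F H)
  then have "disk_integral (\<lambda>z. c * F z + H z) = integral {0..1} (\<lambda>r.
     c * (of_real r * integral {0..2 * pi} (\<lambda>t. F (rcis r t)))
     + of_real r * integral {0..2 * pi} (\<lambda>t. H (rcis r t)))"
    unfolding disk_integral_def by (intro integral_cong) (simp add: algebra_simps)
  also have "\<dots> = c * disk_integral F + disk_integral H"
    unfolding disk_integral_def
    using integrable_on_mult_right[OF disk_integral_integrable[OF F], of c]
    by (subst integral_add) (auto intro!: disk_integral_integrable F H)
  finally show ?thesis .
qed

lemma disk_integral_0 [simp]: "disk_integral (\<lambda>z. 0) = 0"
  by (simp add: disk_integral_def)

lemma disk_integral_sum: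
  assumes "finite A" and "\<And>i. i \<in> A \<Longrightarrow> continuous_on (cball 0 1) (F i)"
  shows "disk_integral (\<lambda>z. \<Sum>i\<in>A. c i * F i z) = (\<Sum>i\<in>A. c i * disk_integral (F i))"
  using assms
proof (induction A rule: finite_induct)
  case (insert i A)
  have "continuous_on (cball 0 1) (\<lambda>z. \<Sum>i\<in>A. c i * F i z)"
    using insert.prems by (auto intro!: continuous_intros)
  then show ?case
    using insert disk_integral_lincomb[of "F i" "\<lambda>z. \<Sum>i\<in>A. c i * F i z" "c i"] by auto
qed auto

lemma disk_integral_bound:
  assumes F: "continuous_on (cball 0 1) F" and B: "\<And>z. z \<in> cball 0 1 \<Longrightarrow> norm (F z) \<le> B"
  shows "norm (disk_integral F) \<le> 2 * pi * B"
proof -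
  have "B \<ge> 0" using order_trans[OF norm_ge_zero B[of 0]] by simp
  have *: "norm (of_real r * integral {0..2 * pi} (\<lambda>t. F (rcis r t))) \<le> 2 * pi * B"
    if r: "r \<in> {0..1}" for r
  proof -
    have "norm (integral {0..2 * pi} (\<lambda>t. F (rcis r t))) \<le> B * (2 * pi - 0)"
      using r by (intro integral_bound circle_continuous F B rcis_in_cball) auto
    moreover have "\<bar>r\<bar> \<le> 1" using r by auto
    ultimately have "\<bar>r\<bar> * norm (integral {0..2 * pi} (\<lambda>t. F (rcis r t))) \<le> 1 * (2 * pi * B)"
      using \<open>B \<ge> 0\<close> by (intro mult_mono) (auto simp: algebra_simps)
    then show ?thesis by (simp add: norm_mult)
  qed
  have "norm (disk_integral F) \<le> 2 * pi * B * (1 - 0)"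
    unfolding disk_integral_def
    by (intro integral_bound * continuous_intros circle_integral_continuous F) auto
  then show ?thesis by simp
qed

text \<open>The factor \<open>r\<close> of the area element hides the value at the origin, which is recovered by continuity
along a radius.\<close>

lemma disk_integral_square_eq_0:
  assumes F: "continuous_on (cball 0 1) F" and 0: "disk_integral (\<lambda>z. F z * cnj (F z)) = 0"
    and z: "z \<in> cball 0 1"
  shows "F z = 0"
proof -
  define u where "u r = integral {0..2 * pi} (\<lambda>t. (cmod (F (rcis r t)))\<^sup>2)" for r
  have sq: "continuous_on (cball 0 1) (\<lambda>z. (cmod (F z))\<^sup>2)"
    by (intro continuous_intros F)
  have u: "continuous_on {0..1} u"
    unfolding u_def by (rule circle_integral_continuous[OF sq])
  have pos: "u r \<ge> 0" if "r \<in> {0..1}" for r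
    unfolding u_def using that
    by (intro integral_nonneg integrable_continuous_interval circle_continuous[OF sq]) auto
  have inner: "integral {0..2 * pi} (\<lambda>t. F (rcis r t) * cnj (F (rcis r t))) = of_real (u r)"
    if "r \<in> {0..1}" for r
    unfolding u_def complex_norm_square[symmetric] using that
    by (intro integral_unique has_integral_of_real integrable_integral integrable_continuous_interval
          circle_continuous[OF sq]) auto
  have "disk_integral (\<lambda>z. F z * cnj (F z)) = integral {0..1} (\<lambda>r. of_real (r * u r))"
    unfolding disk_integral_def by (rule integral_cong) (simp add: inner)
  also have "\<dots> = of_real (integral {0..1} (\<lambda>r. r * u r))"
    by (intro integral_unique has_integral_of_real integrable_integral integrable_continuous_interval
          continuous_intros u)
  finally have "integral {0..1} (\<lambda>r. r * u r) = 0" using 0 by simp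
  moreover have "continuous_on {0..1} (\<lambda>r. r * u r)" by (intro continuous_intros u)
  ultimately have "\<forall>r\<in>{0..1}. r * u r = 0"
    using integral_eq_0_iff[of 0 1 "\<lambda>r. r * u r"] pos by simp
  then have "r * u r = 0" if "0 < r" "r \<le> 1" for r
    by (rule bspec) (use that in simp)
  then have u0: "u r = 0" if "0 < r" "r \<le> 1" for r
    using that by fastforce
  have "F (rcis r t) = 0" if r: "0 < r" "r \<le> 1" and t: "t \<in> {0..2 * pi}" for r t
  proof -
    have "continuous_on {0..2 * pi} (\<lambda>t. (cmod (F (rcis r t)))\<^sup>2)"
      using r by (intro circle_continuous[OF sq]) auto
    then have "\<forall>t\<in>{0..2 * pi}. (cmod (F (rcis r t)))\<^sup>2 = 0"
      using u0[OF r] integral_eq_0_iff[of 0 "2 * pi" "\<lambda>t. (cmod (F (rcis r t)))\<^sup>2"]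
      unfolding u_def by simp
    then show ?thesis using t by simp
  qed
  moreover have "w = rcis (cmod w) (Arg2pi w)" for w
    using Arg2pi_eq[of w] by (simp add: rcis_def cis_conv_exp)
  moreover have "Arg2pi w \<in> {0..2 * pi}" for w
    using Arg2pi_ge_0[of w] Arg2pi_lt_2pi[of w] by simp
  ultimately have Fw: "F w = 0" if "w \<noteq> 0" "cmod w \<le> 1" for w
    using that by (metis zero_less_norm_iff)
  have "F (of_real r) = 0" if "r \<in> {0..1}" for r
  proof (rule continuous_constant_on_closure[where S = "{0<..<1::real}"])
    show "continuous_on (closure {0<..<1}) (\<lambda>r. F (of_real r))"
      by (rule continuous_on_compose2[OF F]) (auto intro!: continuous_intros)
    show "F (of_real r) = 0" if "r \<in> {0<..<1}" for r using Fw that by simp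
    show "r \<in> closure {0<..<1}" using that by simp
  qed
  from this[of 0] Fw[of z] z show ?thesis by (cases "z = 0") auto
qed

section \<open>Continuous functions on the disk are determined by their moments\<close>

definition moments_vanish :: "(complex \<Rightarrow> complex) \<Rightarrow> bool" where
  "moments_vanish F \<longleftrightarrow> continuous_on (cball 0 1) F \<and>
     (\<forall>i j. disk_integral (\<lambda>z. F z * (z ^ i * cnj z ^ j)) = 0)"

lemma moments_vanish_lincomb:
  assumes "moments_vanish F" "moments_vanish H"
  shows "moments_vanish (\<lambda>z. c * F z + H z)"
proof -
  have F: "continuous_on (cball 0 1) F" and H: "continuous_on (cball 0 1) H"
    using assms by (auto simp: moments_vanish_def)
  have "disk_integral (\<lambda>z. (c * F z + H z) * (z ^ i * cnj z ^ j)) = 0" for i j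
  proof -
    have "disk_integral (\<lambda>z. c * (F z * (z ^ i * cnj z ^ j)) + H z * (z ^ i * cnj z ^ j)) = 0"
      using assms
      by (subst disk_integral_lincomb) (auto simp: moments_vanish_def intro!: continuous_intros F H)
    then show ?thesis by (simp add: algebra_simps)
  qed
  then show ?thesis by (auto simp: moments_vanish_def intro!: continuous_intros F H)
qed

lemma moments_vanish_0: "moments_vanish (\<lambda>z. 0)"
  by (simp add: moments_vanish_def)

text \<open>Multiplication by \<open>z\<close> or \<open>cnj z\<close> only shifts the moments, so vanishing of all of them survives
multiplication by a polynomial. Generalising over \<open>F\<close> makes the case of a product immediate.\<close>

lemma moments_vanish_real_polynomial:
  assumes "real_polynomial_function p" and "moments_vanish F"
  shows "moments_vanish (\<lambda>z. F z * of_real (p z))"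
  using assms
proof (induction arbitrary: F)
  case (linear f)
  interpret f: bounded_linear f by fact
  let ?a = "(of_real (f 1) - \<i> * of_real (f \<i>)) / 2 :: complex"
  let ?b = "(of_real (f 1) + \<i> * of_real (f \<i>)) / 2 :: complex"
  have f: "complex_of_real (f z) = ?a * z + ?b * cnj z" for z
  proof -
    have "f z = f (Re z *\<^sub>R 1 + Im z *\<^sub>R \<i>)"
      by (rule arg_cong[where f=f]) (simp add: complex_eq_iff)
    also have "\<dots> = Re z * f 1 + Im z * f \<i>" by (simp add: f.add f.scaleR)
    finally show ?thesis by (simp add: complex_eq_iff field_simps)
  qed
  have z: "moments_vanish (\<lambda>z. F z * z)" and cz: "moments_vanish (\<lambda>z. F z * cnj z)"
  proof -
    have F: "continuous_on (cball 0 1) F"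
      and m: "disk_integral (\<lambda>z. F z * (z ^ i * cnj z ^ j)) = 0" for i j
      using linear.prems unfolding moments_vanish_def by blast+
    have "disk_integral (\<lambda>z. F z * z * (z ^ i * cnj z ^ j)) = 0"
      "disk_integral (\<lambda>z. F z * cnj z * (z ^ i * cnj z ^ j)) = 0" for i j
      using m[of "Suc i" j] m[of i "Suc j"] by (simp_all add: mult_ac)
    moreover have "continuous_on (cball 0 1) (\<lambda>z. F z * z)"
      "continuous_on (cball 0 1) (\<lambda>z. F z * cnj z)"
      by (intro continuous_intros F)+
    ultimately show "moments_vanish (\<lambda>z. F z * z)" "moments_vanish (\<lambda>z. F z * cnj z)"
      unfolding moments_vanish_def by blast+
  qed
  have "moments_vanish (\<lambda>z. ?a * (F z * z) + (?b * (F z * cnj z) + 0))"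
    by (rule moments_vanish_lincomb[OF z moments_vanish_lincomb[OF cz moments_vanish_0]])
  moreover have "F z * of_real (f z) = ?a * (F z * z) + (?b * (F z * cnj z) + 0)" for z
    by (subst f) (simp add: algebra_simps)
  ultimately show ?case by (simp only:)
next
  case (const c)
  have "moments_vanish (\<lambda>z. of_real c * F z + 0)"
    by (rule moments_vanish_lincomb[OF const.prems moments_vanish_0])
  then show ?case by (simp add: mult.commute)
next
  case (add f g)
  have "moments_vanish (\<lambda>z. 1 * (F z * of_real (f z)) + F z * of_real (g z))"
    by (intro moments_vanish_lincomb add)
  then show ?case by (simp add: algebra_simps)
next
  case (mult f g)
  have "moments_vanish (\<lambda>z. F z * of_real (f z) * of_real (g z))"
    by (intro mult)
  then show ?case by (simp add: mult.assoc)
qed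

text \<open>By Stone and Weierstrass, \<open>cnj F\<close> is a uniform limit of polynomials; each of them integrates to \<open>0\<close>
against \<open>F\<close>, hence so does \<open>cnj F\<close> itself.\<close>

lemma moments_vanish_imp_zero:
  assumes F: "moments_vanish F" and z: "z \<in> cball 0 1"
  shows "F z = 0"
proof (rule disk_integral_square_eq_0[OF _ _ z])
  show cont: "continuous_on (cball 0 1) F" using F by (simp add: moments_vanish_def)
  have "bounded (F ` cball 0 1)"
    by (intro compact_imp_bounded compact_continuous_image cont compact_cball)
  then obtain M where "M > 0" and "\<forall>x\<in>F ` cball 0 1. cmod x \<le> M"
    unfolding bounded_pos by blast
  then have M: "\<And>z. z \<in> cball 0 1 \<Longrightarrow> cmod (F z) \<le> M" by blast
  have "cmod (disk_integral (\<lambda>z. F z * cnj (F z))) \<le> 0 + e" if "e > 0" for e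
  proof -
    \<comment> \<open>An error \<open>d\<close> in real and imaginary part changes the integral by at most \<open>2 * pi * M * (2 * d) = e\<close>.\<close>
    define d where "d = e / (4 * pi * M)"
    have d: "d > 0" using that \<open>M > 0\<close> by (simp add: d_def)
    have "continuous_on (cball 0 1) (\<lambda>z. Re (F z))" "continuous_on (cball 0 1) (\<lambda>z. Im (F z))"
      by (intro continuous_intros cont)+
    then obtain g h where g: "real_polynomial_function g" "\<And>z. z \<in> cball 0 1 \<Longrightarrow> \<bar>Re (F z) - g z\<bar> < d"
      and h: "real_polynomial_function h" "\<And>z. z \<in> cball 0 1 \<Longrightarrow> \<bar>Im (F z) - h z\<bar> < d"
      using Stone_Weierstrass_real_polynomial_function[OF compact_cball _ d] by metis
    define R where "R z = cnj (F z) - (of_real (g z) - \<i> * of_real (h z))" for z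
    have "moments_vanish (\<lambda>z. - \<i> * (F z * of_real (h z)) + F z * of_real (g z))"
      by (intro moments_vanish_lincomb moments_vanish_real_polynomial F g(1) h(1))
    then have P: "continuous_on (cball 0 1) (\<lambda>z. - \<i> * (F z * of_real (h z)) + F z * of_real (g z))"
      "\<forall>i j. disk_integral (\<lambda>z. (- \<i> * (F z * of_real (h z)) + F z * of_real (g z)) * (z ^ i * cnj z ^ j)) = 0"
      unfolding moments_vanish_def by blast+
    from P(2)[rule_format, of 0 0]
    have P0: "disk_integral (\<lambda>z. - \<i> * (F z * of_real (h z)) + F z * of_real (g z)) = 0" by simp
    have "continuous_on (cball 0 1)
        (\<lambda>z. F z * cnj (F z) - (- \<i> * (F z * of_real (h z)) + F z * of_real (g z)))"
      by (intro continuous_on_diff P(1) continuous_intros cont)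
    then have R: "continuous_on (cball 0 1) (\<lambda>z. F z * R z)"
      by (rule continuous_on_eq) (simp add: R_def algebra_simps)
    have "disk_integral (\<lambda>z. 1 * (F z * R z) + (- \<i> * (F z * of_real (h z)) + F z * of_real (g z)))
        = disk_integral (\<lambda>z. F z * R z)"
      unfolding disk_integral_lincomb[OF R P(1)] P0 by simp
    moreover have "1 * (F z * R z) + (- \<i> * (F z * of_real (h z)) + F z * of_real (g z)) = F z * cnj (F z)" for z
      by (simp add: R_def algebra_simps)
    ultimately have eq: "disk_integral (\<lambda>z. F z * cnj (F z)) = disk_integral (\<lambda>z. F z * R z)"
      by simp
    have "cmod (F z * R z) \<le> M * (2 * d)" if z: "z \<in> cball 0 1" for z
    proof -
      have "R z = Complex (Re (F z) - g z) (- (Im (F z) - h z))"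
        by (simp add: R_def complex_eq_iff)
      then have "cmod (R z) \<le> \<bar>Re (F z) - g z\<bar> + \<bar>Im (F z) - h z\<bar>"
        using cmod_le[of "R z"] by simp
      also have "\<dots> \<le> 2 * d" using g(2)[OF z] h(2)[OF z] by simp
      finally show ?thesis
        unfolding norm_mult using M[OF z] \<open>M > 0\<close> by (intro mult_mono) auto
    qed
    from disk_integral_bound[OF R this] show ?thesis
      unfolding eq d_def using \<open>M > 0\<close> by simp
  qed
  then have "cmod (disk_integral (\<lambda>z. F z * cnj (F z))) \<le> 0"
    by (rule field_le_epsilon)
  then show "disk_integral (\<lambda>z. F z * cnj (F z)) = 0" by simp
qed

section \<open>Completeness of the scattering polynomials\<close>

lemma scat_core_pairing_expand:
  assumes F: "continuous_on (cball 0 1) F"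
  shows "disk_integral (\<lambda>z. F z * cnj (scat_core p q z)) =
    (\<Sum>m\<le>p + q - 1. of_real (scat_coeff p q m) * disk_integral (\<lambda>z. F z * (z ^ (m - q) * cnj z ^ (m - p))))"
proof -
  have "disk_integral (\<lambda>z. F z * cnj (scat_core p q z)) = disk_integral (\<lambda>z. \<Sum>m\<le>p + q - 1.
      of_real (scat_coeff p q m) * (F z * (z ^ (m - q) * cnj z ^ (m - p))))"
    by (simp add: scat_core_def zpoly_def sum_distrib_left mult_ac)
  then show ?thesis
    by (subst (asm) disk_integral_sum) (auto intro!: continuous_intros F)
qed

text \<open>The moments are found to vanish one after the other: the pairing with \<open>scat_core (i + 1) (j + 1)\<close>
is a non-zero multiple of the moment with exponents \<open>i, j\<close> plus moments with a smaller first
exponent.\<close>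

lemma scat_core_complete:
  assumes F: "continuous_on (cball 0 1) F"
    and orth: "\<And>p q. p > 0 \<Longrightarrow> q > 0 \<Longrightarrow> disk_integral (\<lambda>z. F z * cnj (scat_core p q z)) = 0"
    and z: "z \<in> cball 0 1"
  shows "F z = 0"
proof (rule moments_vanish_imp_zero[OF _ z])
  have "disk_integral (\<lambda>z. F z * (z ^ i * cnj z ^ j)) = 0" for i j
  proof (induction i arbitrary: j rule: less_induct)
    case (less i)
    let ?p = "Suc i" and ?q = "Suc j"
    define t where "t m = of_real (scat_coeff ?p ?q m) *
      disk_integral (\<lambda>z. F z * (z ^ (m - ?q) * cnj z ^ (m - ?p)))" for m
    have "t m = 0" if "m < Suc (i + j)" for m
    proof (cases "m < ?q")
      case True
      then show ?thesis by (simp add: t_def scat_coeff_eq_0)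
    next
      case False
      then have "m - ?q < i" using that by simp
      then show ?thesis by (simp only: t_def less mult_zero_right)
    qed
    then have "(\<Sum>m<Suc (i + j). t m) = 0" by (intro sum.neutral) auto
    moreover have "(\<Sum>m\<le>Suc (i + j). t m) = 0"
      using orth[of ?p ?q] scat_core_pairing_expand[OF F, of ?p ?q] by (simp add: t_def)
    ultimately have "t (Suc (i + j)) = 0"
      by (simp only: lessThan_Suc_atMost[symmetric] sum.lessThan_Suc[of t "Suc (i + j)"] add_0)
    moreover have "scat_coeff ?p ?q (Suc (i + j)) \<noteq> 0"
      using scat_coeff_top[of ?p ?q] by simp
    ultimately show ?case by (simp add: t_def)
  qed
  then show "moments_vanish F" using F by (simp add: moments_vanish_def)
qed

section \<open>Fourier modes of eigenfunctions\<close>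

lemma has_vector_derivative_along:
  assumes "f differentiable at (g x)" and "(g has_vector_derivative v) (at x)"
  shows "((\<lambda>x. f (g x)) has_vector_derivative
    of_real (Re v) * partial_x f (g x) + of_real (Im v) * partial_y f (g x)) (at x)"
  using vector_derivative_diff_chain_within[OF assms(2)
      has_derivative_at_withinI[OF has_derivative_by_partials[OF assms(1)]]]
  by (simp add: o_def scaleR_conv_of_real)

text \<open>The chain rule expressions for the derivatives of \<open>f (rcis r t)\<close> in \<open>r\<close> and in \<open>t\<close>. Negative \<open>r\<close> is admitted:
then \<open>r = 0\<close> is an interior point of the radial interval, and the behaviour of the Fourier modes at
the centre needs no separate discussion.\<close>

definition radial_deriv :: "(complex \<Rightarrow> complex) \<Rightarrow> real \<Rightarrow> real \<Rightarrow> complex" where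
  "radial_deriv f r t = of_real (cos t) * partial_x f (rcis r t) + of_real (sin t) * partial_y f (rcis r t)"

definition angular_deriv :: "(complex \<Rightarrow> complex) \<Rightarrow> real \<Rightarrow> real \<Rightarrow> complex" where
  "angular_deriv f r t = of_real r * (of_real (cos t) * partial_y f (rcis r t) - of_real (sin t) * partial_x f (rcis r t))"

lemma has_radial_deriv:
  assumes "C1_on (ball 0 1) f" "r \<in> {-1<..<1}"
  shows "((\<lambda>r. f (rcis r t)) has_vector_derivative radial_deriv f r t) (at r)"
proof -
  have abs: "\<bar>r\<bar> < 1" using assms(2) by auto
  have "((\<lambda>r. rcis r t) has_vector_derivative cis t) (at r)"
    unfolding rcis_def has_vector_derivative_def
    by (auto intro!: derivative_eq_intros simp: scaleR_conv_of_real)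
  from has_vector_derivative_along[OF C1_on_differentiable[OF assms(1)] this] show ?thesis
    using abs by (simp add: radial_deriv_def)
qed

lemma has_vector_derivative_cis:
  "((\<lambda>t. cis (c * t)) has_vector_derivative of_real c * \<i> * cis (c * t)) (at t)"
proof -
  have "((\<lambda>z. exp (\<i> * (of_real c * z))) has_field_derivative of_real c * \<i> * cis (c * t)) (at (of_real t))"
    by (auto intro!: derivative_eq_intros simp: cis_conv_exp)
  from has_vector_derivative_real_field[OF this] show ?thesis by (simp add: cis_conv_exp)
qed

lemma has_angular_deriv:
  assumes "C1_on (ball 0 1) f" "r \<in> {-1<..<1}"
  shows "((\<lambda>t. f (rcis r t)) has_vector_derivative angular_deriv f r t) (at t)"
proof -
  have abs: "\<bar>r\<bar> < 1" using assms(2) by auto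
  have "((\<lambda>t. rcis r t) has_vector_derivative of_real r * (\<i> * cis t)) (at t)"
    unfolding rcis_def using has_vector_derivative_cis[of 1 t]
    by (intro has_vector_derivative_mult_right) simp
  from has_vector_derivative_along[OF C1_on_differentiable[OF assms(1)] this] show ?thesis
    using abs by (simp add: angular_deriv_def algebra_simps)
qed

lemma polar_continuous:
  assumes "continuous_on (ball 0 1) g"
  shows "continuous_on ({-1<..<1} \<times> S) (\<lambda>x. g (rcis (fst x) (snd x)))"
  by (rule continuous_on_compose2[OF assms]) (auto intro!: continuous_intros)

lemma polar_continuous_angle:
  assumes "continuous_on (ball 0 1) g" "r \<in> {-1<..<1}"
  shows "continuous_on S (\<lambda>t. g (rcis r t))"
  by (rule continuous_on_compose2[OF assms(1)]) (use assms(2) in \<open>auto intro!: continuous_intros\<close>)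

definition fourier_mode :: "int \<Rightarrow> (complex \<Rightarrow> complex) \<Rightarrow> real \<Rightarrow> complex" where
  "fourier_mode n f r = integral {0..2 * pi} (\<lambda>t. f (rcis r t) * cis (- of_int n * t))"

lemma fourier_integral_derivative:
  assumes deriv: "\<And>r t. r \<in> {-1<..<1} \<Longrightarrow> ((\<lambda>r. H r t) has_vector_derivative H' r t) (at r)"
    and cont: "continuous_on ({-1<..<1} \<times> {0..2 * pi}) (\<lambda>x. H' (fst x) (snd x))"
    and contH: "\<And>r. r \<in> {-1<..<1} \<Longrightarrow> continuous_on {0..2 * pi} (H r)"
    and r: "r \<in> {-1<..<1}"
  shows "((\<lambda>r. integral {0..2 * pi} (\<lambda>t. H r t * cis (c * t))) has_vector_derivative
    integral {0..2 * pi} (\<lambda>t. H' r t * cis (c * t))) (at r)"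
proof -
  have "((\<lambda>r. integral (cbox 0 (2 * pi)) (\<lambda>t. H r t * cis (c * t))) has_vector_derivative
    integral (cbox 0 (2 * pi)) (\<lambda>t. H' r t * cis (c * t))) (at r within {-1<..<1})"
  proof (rule leibniz_rule_vector_derivative)
    show "((\<lambda>r. H r t * cis (c * t)) has_vector_derivative H' r t * cis (c * t)) (at r within {-1<..<1})"
      if "r \<in> {-1<..<1}" for r t
      by (intro has_vector_derivative_mult_left has_vector_derivative_at_within[OF deriv] that)
    show "(\<lambda>t. H r t * cis (c * t)) integrable_on cbox 0 (2 * pi)" if "r \<in> {-1<..<1}" for r
      using contH[OF that] by (intro integrable_continuous continuous_intros) auto
    show "continuous_on ({-1<..<1} \<times> cbox 0 (2 * pi)) (\<lambda>(r, t). H' r t * cis (c * t))"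
      unfolding case_prod_unfold using cont by (auto intro!: continuous_intros)
  qed (use r in auto)
  then show ?thesis by (simp only: at_within_open[OF r open_greaterThanLessThan] cbox_interval)
qed

text \<open>The polar form of the Laplacian, multiplied by \<open>r ^ 2\<close>, is integrated against \<open>cis (- n * t)\<close>. The
radial derivatives move out of the integral, and two integrations by parts turn the second angular
derivative into the factor \<open>- (n ^ 2)\<close>.\<close>

lemma fourier_mode_ode:
  assumes C2: "C2_on (ball 0 1) f"
    and eq: "\<And>z. z \<in> ball 0 1 \<Longrightarrow> laplace_tilde f z + k * f z = 0"
  obtains a1 a2 where
    "\<And>r. r \<in> {-1<..<1} \<Longrightarrow> (fourier_mode n f has_vector_derivative a1 r) (at r)"
    "\<And>r. r \<in> {-1<..<1} \<Longrightarrow> (a1 has_vector_derivative a2 r) (at r)"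
    "\<And>r. r \<in> {-1<..<1} \<Longrightarrow> (1 - of_real r ^ 2) * (of_real r ^ 2 * a2 r + of_real r * a1 r
        - of_int n ^ 2 * fourier_mode n f r) = - 4 * k * of_real r ^ 2 * fourier_mode n f r"
proof -
  have C: "C1_on (ball 0 1) f" "C1_on (ball 0 1) (partial_x f)" "C1_on (ball 0 1) (partial_y f)"
    using C2 by (auto simp: C2_on_def)
  have cont: "continuous_on (ball 0 1) f" "continuous_on (ball 0 1) (partial_x f)"
    "continuous_on (ball 0 1) (partial_y f)"
    "continuous_on (ball 0 1) (partial_x (partial_x f))" "continuous_on (ball 0 1) (partial_y (partial_x f))"
    "continuous_on (ball 0 1) (partial_x (partial_y f))" "continuous_on (ball 0 1) (partial_y (partial_y f))"
    using C by (auto simp: C1_on_def intro: differentiable_imp_continuous_on)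
  note pc = cont[THEN polar_continuous] and pca = cont[THEN polar_continuous_angle]
  let ?e = "\<lambda>t. cis (- of_int n * t)"
  let ?I = "\<lambda>h. integral {0..2 * pi} (\<lambda>t. h t * ?e t)"
  define f_rr where "f_rr r t = of_real (cos t) * radial_deriv (partial_x f) r t
      + of_real (sin t) * radial_deriv (partial_y f) r t" for r t
  define f_tt where "f_tt r t = of_real r *
     (of_real (cos t) * angular_deriv (partial_y f) r t - of_real (sin t) * partial_y f (rcis r t)
      - of_real (sin t) * angular_deriv (partial_x f) r t - of_real (cos t) * partial_x f (rcis r t))" for r t
  define a1 where "a1 r = ?I (radial_deriv f r)" for r
  define a2 where "a2 r = ?I (f_rr r)" for r
  have f_rr: "((\<lambda>r. radial_deriv f r t) has_vector_derivative f_rr r t) (at r)" if "r \<in> {-1<..<1}" for r t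
    unfolding radial_deriv_def[of f] f_rr_def
    by (intro has_vector_derivative_add has_vector_derivative_mult_right has_radial_deriv C that)
  have cosd: "((\<lambda>t. complex_of_real (cos t)) has_vector_derivative of_real (- sin t)) (at t)"
    and sind: "((\<lambda>t. complex_of_real (sin t)) has_vector_derivative of_real (cos t)) (at t)" for t
    by (auto intro!: has_vector_derivative_of_real derivative_eq_intros
        simp: has_real_derivative_iff_has_vector_derivative[symmetric])
  have f_tt: "((\<lambda>t. angular_deriv f r t) has_vector_derivative f_tt r t) (at t)" if "r \<in> {-1<..<1}" for r t
    unfolding angular_deriv_def[of f] f_tt_def
    using has_vector_derivative_mult_right[OF has_vector_derivative_diff[OF
        has_vector_derivative_mult[OF cosd has_angular_deriv[OF C(3) that]]
        has_vector_derivative_mult[OF sind has_angular_deriv[OF C(2) that]]], of "of_real r"]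
    by (simp add: algebra_simps)
  have "(fourier_mode n f has_vector_derivative a1 r) (at r)" if r: "r \<in> {-1<..<1}" for r
    unfolding fourier_mode_def[abs_def] a1_def
    by (rule fourier_integral_derivative[OF has_radial_deriv[OF C(1)] _ _ r])
       (auto simp: radial_deriv_def intro!: continuous_intros pc pca)
  moreover have "(a1 has_vector_derivative a2 r) (at r)" if r: "r \<in> {-1<..<1}" for r
    unfolding a1_def[abs_def] a2_def
    by (rule fourier_integral_derivative[OF f_rr _ _ r])
       (auto simp: f_rr_def radial_deriv_def intro!: continuous_intros pc pca)
  moreover have "(1 - of_real r ^ 2) * (of_real r ^ 2 * a2 r + of_real r * a1 r
        - of_int n ^ 2 * fourier_mode n f r) = - 4 * k * of_real r ^ 2 * fourier_mode n f r"
    if r: "r \<in> {-1<..<1}" for r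
  proof -
    have int: "(\<lambda>t. f (rcis r t) * ?e t) integrable_on {0..2 * pi}"
      "(\<lambda>t. radial_deriv f r t * ?e t) integrable_on {0..2 * pi}"
      "(\<lambda>t. f_rr r t * ?e t) integrable_on {0..2 * pi}"
      unfolding f_rr_def radial_deriv_def
      by (auto intro!: integrable_continuous_interval continuous_intros pca r)
    \<comment> \<open>An antiderivative that performs both integrations by parts at once; it is periodic.\<close>
    define E where "E t = (angular_deriv f r t + \<i> * of_int n * f (rcis r t)) * ?e t" for t
    have "(E has_vector_derivative (f_tt r t + of_int n ^ 2 * f (rcis r t)) * ?e t) (at t)" for t
      unfolding E_def
      using has_vector_derivative_mult[OF has_vector_derivative_add[OF f_tt[OF r]
          has_vector_derivative_mult_right[OF has_angular_deriv[OF C(1) r], of "\<i> * of_int n"]]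
          has_vector_derivative_cis[of "- of_int n"], of t]
      by (simp add: algebra_simps power2_eq_square)
    note E = has_vector_derivative_at_within[OF this]
    have "((\<lambda>t. (f_tt r t + of_int n ^ 2 * f (rcis r t)) * ?e t) has_integral (E (2 * pi) - E 0)) {0..2 * pi}"
      by (rule fundamental_theorem_of_calculus[OF _ E]) simp
    moreover have "E (2 * pi) = E 0"
    proof -
      have "cis (- of_int n * (2 * pi)) = 1"
        using cis_multiple_2pi[of "- of_int n"] by (simp add: mult_ac)
      then show ?thesis by (simp add: E_def angular_deriv_def rcis_def)
    qed
    ultimately have ibp: "((\<lambda>t. (f_tt r t + of_int n ^ 2 * f (rcis r t)) * ?e t) has_integral 0) {0..2 * pi}"
      by simp
    have alg1: "x * S = - 4 * k * F" if "x / 4 * S + k * F = 0" for x S F :: complex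
      using that by (simp add: field_simps eq_neg_iff_add_eq_0)
    have alg2: "R\<^sup>2 * (c * (c * a + s * b) + s * (c * d + s * e)) + R * (c * X + s * Y)
        + R * (c * (R * (c * e - s * d)) - s * Y - s * (R * (c * b - s * a)) - c * X)
        = R\<^sup>2 * ((c\<^sup>2 + s\<^sup>2) * (a + e))" for R c s a b d e X Y :: complex
      by (simp add: algebra_simps power2_eq_square)
    have alg3: "x * (R2 * (A * e) + R * (B * e) - N * (F * e) + (T + N * F) * e)
        = x * (R2 * A + R * B + T) * e" for x R2 A e R B N F T :: complex
      by (simp add: algebra_simps power2_eq_square)
    have lap: "(1 - of_real r ^ 2) * (of_real r ^ 2 * f_rr r t + of_real r * radial_deriv f r t + f_tt r t)
        = - 4 * k * of_real r ^ 2 * f (rcis r t)" for t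
    proof -
      let ?z = "rcis r t"
      have "(Re ?z)\<^sup>2 + (Im ?z)\<^sup>2 = r\<^sup>2"
        using cmod_power2[of ?z] by simp
      then have "complex_of_real ((1 - (Re ?z)\<^sup>2 - (Im ?z)\<^sup>2) / 4) = (1 - of_real r ^ 2) / 4"
        by (simp only: diff_diff_eq of_real_diff of_real_divide of_real_power of_real_1 of_real_numeral)
      note weight = this
      let ?S = "partial_x (partial_x f) ?z + partial_y (partial_y f) ?z"
      have "?z \<in> ball 0 1" using r by auto
      from eq[OF this] have "(1 - of_real r ^ 2) / 4 * ?S + k * f ?z = 0"
        unfolding laplace_tilde_def weight .
      then have L: "(1 - of_real r ^ 2) * ?S = - 4 * k * f ?z" by (rule alg1)
      have "complex_of_real (cos t) ^ 2 + of_real (sin t) ^ 2 = of_real ((cos t)\<^sup>2 + (sin t)\<^sup>2)"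
        by (simp only: of_real_add of_real_power)
      then have cs: "complex_of_real (cos t) ^ 2 + of_real (sin t) ^ 2 = 1"
        by (simp only: sin_cos_squared_add2 of_real_1)
      have "of_real r ^ 2 * f_rr r t + of_real r * radial_deriv f r t + f_tt r t =
        of_real r ^ 2 * ((complex_of_real (cos t) ^ 2 + of_real (sin t) ^ 2) *
          (partial_x (partial_x f) ?z + partial_y (partial_y f) ?z))"
        unfolding f_rr_def f_tt_def radial_deriv_def angular_deriv_def by (rule alg2)
      then have "(1 - of_real r ^ 2) * (of_real r ^ 2 * f_rr r t + of_real r * radial_deriv f r t + f_tt r t)
          = of_real r ^ 2 * ((1 - of_real r ^ 2) * ?S)"
        unfolding cs by (simp only: mult_1_left mult.left_commute)
      then show ?thesis unfolding L by (simp only: mult_ac mult_minus_left mult_minus_right)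
    qed
    have "((\<lambda>t. of_real r ^ 2 * (f_rr r t * ?e t) + of_real r * (radial_deriv f r t * ?e t)
          - of_int n ^ 2 * (f (rcis r t) * ?e t) + (f_tt r t + of_int n ^ 2 * f (rcis r t)) * ?e t) has_integral
        (of_real r ^ 2 * a2 r + of_real r * a1 r - of_int n ^ 2 * fourier_mode n f r + 0)) {0..2 * pi}"
      unfolding a1_def a2_def fourier_mode_def
      by (intro has_integral_add has_integral_diff has_integral_mult_right ibp integrable_integral int)
    then have total: "((\<lambda>t. (1 - of_real r ^ 2) * (of_real r ^ 2 * (f_rr r t * ?e t) + of_real r * (radial_deriv f r t * ?e t)
          - of_int n ^ 2 * (f (rcis r t) * ?e t) + (f_tt r t + of_int n ^ 2 * f (rcis r t)) * ?e t)) has_integral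
        (1 - of_real r ^ 2) * (of_real r ^ 2 * a2 r + of_real r * a1 r - of_int n ^ 2 * fourier_mode n f r + 0)) {0..2 * pi}"
      by (rule has_integral_mult_right)
    have integrand: "(1 - of_real r ^ 2) * (of_real r ^ 2 * (f_rr r t * ?e t) + of_real r * (radial_deriv f r t * ?e t)
          - of_int n ^ 2 * (f (rcis r t) * ?e t) + (f_tt r t + of_int n ^ 2 * f (rcis r t)) * ?e t)
        = - 4 * k * of_real r ^ 2 * (f (rcis r t) * ?e t)" for t
    proof -
      have "(1 - of_real r ^ 2) * (of_real r ^ 2 * (f_rr r t * ?e t) + of_real r * (radial_deriv f r t * ?e t)
          - of_int n ^ 2 * (f (rcis r t) * ?e t) + (f_tt r t + of_int n ^ 2 * f (rcis r t)) * ?e t)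
        = (1 - of_real r ^ 2) * (of_real r ^ 2 * f_rr r t + of_real r * radial_deriv f r t + f_tt r t) * ?e t"
        by (rule alg3)
      then show ?thesis unfolding lap by (simp only: mult.assoc)
    qed
    have "((\<lambda>t. - 4 * k * of_real r ^ 2 * (f (rcis r t) * ?e t)) has_integral
        - 4 * k * of_real r ^ 2 * fourier_mode n f r) {0..2 * pi}"
      unfolding fourier_mode_def by (intro has_integral_mult_right integrable_integral int)
    from has_integral_unique[OF total[unfolded integrand add_0_right] this] show ?thesis .
  qed
  ultimately show ?thesis by (rule that)
qed

section \<open>Fourier modes of the scattering polynomials\<close>

lemma fourier_mode_continuous:
  assumes "continuous_on (cball 0 1) f"
  shows "continuous_on {0..1} (fourier_mode n f)"
proof -
  have "continuous_on ({0..1} \<times> cbox 0 (2 * pi)) (\<lambda>(r, t). f (rcis r t) * cis (- of_int n * t))"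
    unfolding case_prod_unfold
    by (intro continuous_intros continuous_on_compose2[OF assms, of _ "\<lambda>x. rcis (fst x) (snd x)"]) auto
  from integral_continuous_on_param[OF this] show ?thesis
    by (simp add: fourier_mode_def[abs_def])
qed

lemma integral_cis_int:
  "integral {0..2 * pi} (\<lambda>t. cis (of_int m * t)) = (if m = 0 then 2 * of_real pi else 0)"
proof (cases "m = 0")
  case False
  have E: "((\<lambda>t. cis (of_int m * t) / (\<i> * of_int m)) has_vector_derivative cis (of_int m * t)) (at t within S)"
    for t S
    using has_vector_derivative_at_within[OF has_vector_derivative_mult_left[OF
        has_vector_derivative_cis[of "of_int m" t], of "1 / (\<i> * of_int m)"]] False
    by simp
  have "cis (of_int m * (2 * pi)) = 1"
    using cis_multiple_2pi[of "of_int m"] by (simp add: mult_ac)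
  moreover have "((\<lambda>t. cis (of_int m * t)) has_integral
      (cis (of_int m * (2 * pi)) / (\<i> * of_int m) - cis (of_int m * 0) / (\<i> * of_int m))) {0..2 * pi}"
    by (rule fundamental_theorem_of_calculus[OF _ E]) simp
  ultimately have "((\<lambda>t. cis (of_int m * t)) has_integral 0) {0..2 * pi}" by simp
  then show ?thesis using False by (simp add: integral_unique)
qed (simp add: scaleR_conv_of_real)

text \<open>All monomials of \<open>scat_core p q\<close> with non-zero coefficient have the same difference of exponents
\<open>q - p\<close>, so a single Fourier mode is present.\<close>

lemma scat_core_rcis:
  "scat_core p q (rcis r t) = scat_core p q (of_real r) * cis (of_int (int q - int p) * t)"
proof -
  have "of_real (scat_coeff p q m) * rcis r t ^ (m - p) * cnj (rcis r t) ^ (m - q) =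
    of_real (scat_coeff p q m) * of_real r ^ (m - p) * cnj (of_real r) ^ (m - q) * cis (of_int (int q - int p) * t)" for m
  proof (cases "m < p \<or> m < q")
    case False
    then have "of_nat (m - p) * t + of_nat (m - q) * - t = of_int (int q - int p) * t"
      by (simp add: of_nat_diff algebra_simps)
    then have "cis t ^ (m - p) * cis (- t) ^ (m - q) = cis (of_int (int q - int p) * t)"
      unfolding Complex.DeMoivre cis_mult by simp
    then show ?thesis by (simp add: rcis_def power_mult_distrib cis_cnj mult_ac)
  qed (simp add: scat_coeff_eq_0)
  then show ?thesis by (simp only: scat_core_def zpoly_def sum_distrib_right)
qed

lemma cnj_scat_core_of_real: "cnj (scat_core p q (of_real r)) = scat_core p q (of_real r)"
  by (simp add: scat_core_def zpoly_def)

lemma fourier_mode_scattering_poly: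
  assumes "\<bar>r\<bar> \<le> 1"
  shows "fourier_mode n (on_closed_disk (scattering_poly p q)) r =
    (if n = int q - int p then 2 * of_real pi else 0) * ((1 - of_real r ^ 2) * scat_core p q (of_real r))"
proof -
  have "on_closed_disk (scattering_poly p q) (rcis r t) * cis (- of_int n * t) =
      (1 - of_real r ^ 2) * scat_core p q (of_real r) * cis (of_int (int q - int p - n) * t)" for t
  proof -
    have "rcis r t * cnj (rcis r t) = of_real r ^ 2"
      unfolding complex_norm_square[symmetric] by (simp flip: of_real_power)
    then have "on_closed_disk (scattering_poly p q) (rcis r t) * cis (- of_int n * t) =
       (1 - of_real r ^ 2) * scat_core p q (of_real r) *
         (cis (of_int (int q - int p) * t) * cis (- of_int n * t))"
      using assms by (simp add: on_closed_disk_scattering_poly scat_core_rcis mult.assoc)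
    then show ?thesis unfolding cis_mult by (simp add: algebra_simps)
  qed
  then show ?thesis
    unfolding fourier_mode_def by (simp only: integral_mult_right integral_cis_int) auto
qed

lemma disk_integral_scat_core:
  "disk_integral (\<lambda>z. f z * cnj (scat_core p q z)) =
   integral {0..1} (\<lambda>r. of_real r * (scat_core p q (of_real r) * fourier_mode (int q - int p) f r))"
proof -
  have "f (rcis r t) * cnj (scat_core p q (rcis r t)) =
      scat_core p q (of_real r) * (f (rcis r t) * cis (- of_int (int q - int p) * t))" for r t
    by (simp add: scat_core_rcis cnj_scat_core_of_real cis_cnj algebra_simps)
  then show ?thesis
    unfolding disk_integral_def fourier_mode_def by (simp only: integral_mult_right)
qed

section \<open>Orthogonality of eigenfunctions to scattering polynomials\<close>

text \<open>If \<open>L\<close> were non-zero, \<open>v\<close> would behave like \<open>- L * ln (1 - r)\<close> by the rule of l'Hopital and could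
not converge.\<close>

lemma no_logarithmic_growth:
  fixes v :: "real \<Rightarrow> complex"
  assumes lim: "(v \<longlongrightarrow> c) (at_left 1)"
    and deriv: "\<forall>\<^sub>F r in at_left 1. (v has_vector_derivative v' r) (at r)"
    and L: "((\<lambda>r. (1 - of_real r) * v' r) \<longlongrightarrow> L) (at_left 1)"
  shows "L = 0"
proof -
  have real_case: "l = 0"
    if "(u \<longlongrightarrow> d) (at_left 1)" and du: "\<forall>\<^sub>F r in at_left 1. (u has_real_derivative u' r) (at r)"
      and l: "((\<lambda>r. (1 - r) * u' r) \<longlongrightarrow> l) (at_left 1)" for u u' :: "real \<Rightarrow> real" and d l
  proof -
    have lt: "\<forall>\<^sub>F r::real in at_left 1. r < 1" by (simp add: eventually_at_filter)
    have top: "filterlim (\<lambda>r::real. - ln (1 - r)) at_top (at_left 1)"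
    proof -
      have "filterlim (\<lambda>r::real. 1 - r) (at_right 0) (at_left 1)"
        unfolding filterlim_at using lt
        by (auto intro!: tendsto_eq_intros elim: eventually_mono)
      from filterlim_compose[OF ln_at_0 this] show ?thesis
        by (simp add: filterlim_uminus_at_top)
    qed
    have "((\<lambda>r. u r / - ln (1 - r)) \<longlongrightarrow> l) (at_left 1)"
    proof (rule lhopital_left_at_top[OF top _ du])
      show "\<forall>\<^sub>F r::real in at_left 1. 1 / (1 - r) \<noteq> 0"
        using lt by eventually_elim simp
      show "\<forall>\<^sub>F r::real in at_left 1. ((\<lambda>r. - ln (1 - r)) has_real_derivative 1 / (1 - r)) (at r)"
        using lt by eventually_elim (auto intro!: derivative_eq_intros)
      show "((\<lambda>r. u' r / (1 / (1 - r))) \<longlongrightarrow> l) (at_left 1)" using l by (simp add: mult.commute)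
    qed
    moreover have "((\<lambda>r. u r / - ln (1 - r)) \<longlongrightarrow> 0) (at_left 1)"
      by (rule tendsto_divide_0[OF that(1) filterlim_at_top_imp_at_infinity[OF top]])
    ultimately show "l = 0" by (intro tendsto_unique) auto
  qed
  have "Re L = 0"
  proof (rule real_case)
    show "((\<lambda>r. Re (v r)) \<longlongrightarrow> Re c) (at_left 1)" by (intro tendsto_intros lim)
    show "\<forall>\<^sub>F r in at_left 1. ((\<lambda>r. Re (v r)) has_real_derivative Re (v' r)) (at r)"
      using deriv by eventually_elim
        (auto simp: has_real_derivative_iff_has_vector_derivative
          intro: bounded_linear.has_vector_derivative[OF bounded_linear_Re])
    show "((\<lambda>r. (1 - r) * Re (v' r)) \<longlongrightarrow> Re L) (at_left 1)"
      using tendsto_Re[OF L] by simp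
  qed
  moreover have "Im L = 0"
  proof (rule real_case)
    show "((\<lambda>r. Im (v r)) \<longlongrightarrow> Im c) (at_left 1)" by (intro tendsto_intros lim)
    show "\<forall>\<^sub>F r in at_left 1. ((\<lambda>r. Im (v r)) has_real_derivative Im (v' r)) (at r)"
      using deriv by eventually_elim
        (auto simp: has_real_derivative_iff_has_vector_derivative
          intro: bounded_linear.has_vector_derivative[OF bounded_linear_Im])
    show "((\<lambda>r. (1 - r) * Im (v' r)) \<longlongrightarrow> Im L) (at_left 1)"
      using tendsto_Im[OF L] by simp
  qed
  ultimately show ?thesis by (simp add: complex_eq_iff)
qed

lemma scat_core_radial_derivative:
  "((\<lambda>r. scat_core p q (of_real r)) has_vector_derivative partial_x (scat_core p q) (of_real r)) (at r)"
proof -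
  have "((\<lambda>r. of_real r :: complex) has_vector_derivative 1) (at r)"
    by (auto simp: has_vector_derivative_def scaleR_conv_of_real intro!: derivative_eq_intros)
  from has_vector_derivative_along[OF _ this, of "scat_core p q"] show ?thesis
    by (simp add: scat_core_def)
qed

lemma continuous_partial_x_scat_core: "continuous_on S (partial_x (scat_core p q))"
  using C1_on_zpoly unfolding scat_core_def C1_on_def by blast

text \<open>This is Green's formula, applied to one Fourier mode \<open>a\<close> of the eigenfunction and to the corresponding
mode \<open>b\<close> of the scattering polynomial. The radial Wronskian \<open>W\<close> vanishes at the centre and its
derivative is a constant times \<open>k - p * q\<close> times the integrand of the pairing, so it remains to be seen that \<open>W\<close> tends
to \<open>0\<close> at the boundary. There \<open>f\<close> is only known to be continuous, and the term \<open>b * a1\<close> is not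
controlled directly. But \<open>b\<close> is a constant times \<open>(1 - r ^ 2) * g\<close> with \<open>g\<close> smooth, so the
limit of \<open>W\<close>, which exists because it is an integral, is up to a factor the limit of \<open>1 - r\<close> times
the derivative of \<open>g * a\<close>. As \<open>g * a\<close> converges, this limit is \<open>0\<close>.\<close>

lemma eigenfunction_scat_core_orthogonal:
  assumes f: "f \<in> dirichlet_ker k" and pq: "p > 0" "q > 0"
  shows "(k - of_nat (p * q)) * disk_integral (\<lambda>z. f z * cnj (scat_core p q z)) = 0"
proof -
  define n where "n = int q - int p"
  define K where "K = complex_of_nat (p * q)"
  define \<phi> where "\<phi> = on_closed_disk (scattering_poly p q)"
  define a where "a = fourier_mode n f"
  define b where "b = fourier_mode n \<phi>"
  define g where "g r = scat_core p q (complex_of_real r)" for r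
  define g1 where "g1 r = partial_x (scat_core p q) (complex_of_real r)" for r
  have fC2: "C2_on (ball 0 1) f" and feq: "\<And>z. z \<in> ball 0 1 \<Longrightarrow> laplace_tilde f z + k * f z = 0"
    and fcont: "continuous_on (cball 0 1) f" and f0: "\<And>z. z \<in> sphere 0 1 \<Longrightarrow> f z = 0"
    using f by (auto simp: dirichlet_ker_def dirichlet_functions_def)
  have \<phi>: "\<phi> \<in> dirichlet_ker K" unfolding \<phi>_def K_def by (rule scattering_poly_in_ker[OF pq])
  then have \<phi>C2: "C2_on (ball 0 1) \<phi>" and \<phi>eq: "\<And>z. z \<in> ball 0 1 \<Longrightarrow> laplace_tilde \<phi> z + K * \<phi> z = 0"
    by (auto simp: dirichlet_ker_def dirichlet_functions_def)
  obtain a1 a2 where a1: "\<And>r. r \<in> {-1<..<1} \<Longrightarrow> (a has_vector_derivative a1 r) (at r)"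
    and a2: "\<And>r. r \<in> {-1<..<1} \<Longrightarrow> (a1 has_vector_derivative a2 r) (at r)"
    and ode_a: "\<And>r. r \<in> {-1<..<1} \<Longrightarrow> (1 - of_real r ^ 2) * (of_real r ^ 2 * a2 r + of_real r * a1 r
        - of_int n ^ 2 * a r) = - 4 * k * of_real r ^ 2 * a r"
    using fourier_mode_ode[OF fC2 feq] unfolding a_def by metis
  obtain b1 b2 where b1: "\<And>r. r \<in> {-1<..<1} \<Longrightarrow> (b has_vector_derivative b1 r) (at r)"
    and b2: "\<And>r. r \<in> {-1<..<1} \<Longrightarrow> (b1 has_vector_derivative b2 r) (at r)"
    and ode_b: "\<And>r. r \<in> {-1<..<1} \<Longrightarrow> (1 - of_real r ^ 2) * (of_real r ^ 2 * b2 r + of_real r * b1 r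
        - of_int n ^ 2 * b r) = - 4 * K * of_real r ^ 2 * b r"
    using fourier_mode_ode[OF \<phi>C2 \<phi>eq] unfolding b_def by metis
  have g1: "(g has_vector_derivative g1 r) (at r)" for r
    unfolding g_def[abs_def] g1_def by (rule scat_core_radial_derivative)
  have g_cont: "continuous_on S g" "continuous_on S g1" for S
    unfolding g_def[abs_def] g1_def[abs_def]
    by (intro continuous_on_compose2[OF continuous_on_scat_core[of UNIV]]
        continuous_on_compose2[OF continuous_partial_x_scat_core[of UNIV]] continuous_intros; simp)+
  have b: "b r = 2 * of_real pi * ((1 - of_real r ^ 2) * g r)" if "\<bar>r\<bar> \<le> 1" for r
    using fourier_mode_scattering_poly[OF that, of n p q] by (simp add: b_def \<phi>_def n_def g_def)
  have a_cont: "continuous_on {0..1} a" unfolding a_def by (rule fourier_mode_continuous[OF fcont])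
  have "a 1 = 0" unfolding a_def fourier_mode_def by (simp add: f0)
  then have a_lim: "(a \<longlongrightarrow> 0) (at_left 1)"
    using continuous_on_Icc_at_leftD[OF a_cont] by simp
  have g_lim: "(g \<longlongrightarrow> g 1) (at_left 1)" "(g1 \<longlongrightarrow> g1 1) (at_left 1)"
    using continuous_on_Icc_at_leftD[OF g_cont(1), of 0 1] continuous_on_Icc_at_leftD[OF g_cont(2), of 0 1]
    by simp_all
  have b1_eq: "b1 r = 2 * of_real pi * ((1 - of_real r ^ 2) * g1 r - 2 * of_real r * g r)"
    if r: "r \<in> {-1<..<1}" for r
  proof -
    have "((\<lambda>r. (1 - complex_of_real r ^ 2)) has_vector_derivative - 2 * of_real r) (at r)"
      by (auto simp: has_vector_derivative_def scaleR_conv_of_real fun_eq_iff intro!: derivative_eq_intros)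
    from has_vector_derivative_mult_right[OF has_vector_derivative_mult[OF this g1], of "2 * of_real pi"]
    have "((\<lambda>r. 2 * of_real pi * ((1 - of_real r ^ 2) * g r)) has_vector_derivative
        2 * of_real pi * ((1 - of_real r ^ 2) * g1 r - 2 * of_real r * g r)) (at r)"
      by (simp add: algebra_simps)
    then have "(b has_vector_derivative
        2 * of_real pi * ((1 - of_real r ^ 2) * g1 r - 2 * of_real r * g r)) (at r)"
      by (rule has_vector_derivative_transform_within_open[OF _ open_greaterThanLessThan r])
         (auto simp: b)
    from vector_derivative_unique_at[OF b1[OF r] this] show ?thesis .
  qed
  define W where "W r = of_real r * (a r * b1 r - b r * a1 r)" for r
  define h where "h r = of_real r * (g r * a r)" for r
  have W_deriv: "(W has_vector_derivative (8 * of_real pi * (k - K)) * h r) (at r)"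
    if r: "r \<in> {0<..<1}" for r
  proof -
    have r': "r \<in> {-1<..<1}" using r by auto
    have "((\<lambda>r. of_real r :: complex) has_vector_derivative 1) (at r)"
      by (auto simp: has_vector_derivative_def scaleR_conv_of_real intro!: derivative_eq_intros)
    from has_vector_derivative_mult[OF this has_vector_derivative_diff[OF
        has_vector_derivative_mult[OF a1[OF r'] b2[OF r']] has_vector_derivative_mult[OF b1[OF r'] a2[OF r']]]]
    have "(W has_vector_derivative (of_real r * (a r * b2 r - b r * a2 r) + (a r * b1 r - b r * a1 r))) (at r)"
      by (simp add: W_def[abs_def] algebra_simps)
    moreover have "of_real r * (a r * b2 r - b r * a2 r) + (a r * b1 r - b r * a1 r) = (8 * of_real pi * (k - K)) * h r"
    proof -
      let ?R = "complex_of_real r"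
      have "r\<^sup>2 \<noteq> 1" using r by (auto simp: power2_eq_1_iff)
      then have nz: "?R * (1 - ?R\<^sup>2) \<noteq> 0" using r by (simp flip: of_real_power)
      have br: "b r = 2 * of_real pi * ((1 - ?R\<^sup>2) * g r)" using r by (intro b) auto
      \<comment> \<open>The Wronskian combination of the two equations eliminates the terms with \<open>N = n ^ 2\<close>.\<close>
      have alg: "R * (1 - R\<^sup>2) * (R * (A * B2 - B * A2) + (A * B1 - B * A1)) = 4 * (k - K) * R\<^sup>2 * A * B"
        if "(1 - R\<^sup>2) * (R\<^sup>2 * A2 + R * A1 - N * A) = - 4 * k * R\<^sup>2 * A"
          "(1 - R\<^sup>2) * (R\<^sup>2 * B2 + R * B1 - N * B) = - 4 * K * R\<^sup>2 * B" for R A A1 A2 B B1 B2 N :: complex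
      proof -
        have "R * (1 - R\<^sup>2) * (R * (A * B2 - B * A2) + (A * B1 - B * A1)) =
          A * ((1 - R\<^sup>2) * (R\<^sup>2 * B2 + R * B1 - N * B)) - B * ((1 - R\<^sup>2) * (R\<^sup>2 * A2 + R * A1 - N * A))"
          by (simp add: algebra_simps power2_eq_square)
        also have "\<dots> = 4 * (k - K) * R\<^sup>2 * A * B" unfolding that by (simp add: algebra_simps)
        finally show ?thesis .
      qed
      have "?R * (1 - ?R\<^sup>2) * (?R * (a r * b2 r - b r * a2 r) + (a r * b1 r - b r * a1 r))
          = 4 * (k - K) * ?R\<^sup>2 * a r * b r"
        by (rule alg[OF ode_a[OF r'] ode_b[OF r']])
      also have "\<dots> = ?R * (1 - ?R\<^sup>2) * ((8 * of_real pi * (k - K)) * h r)"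
        unfolding br h_def by (simp add: algebra_simps power2_eq_square)
      finally show ?thesis using nz by (simp only: mult_cancel_left) simp
    qed
    ultimately show ?thesis by simp
  qed
  have h_cont: "continuous_on {0..1} h"
    unfolding h_def[abs_def] by (intro continuous_intros g_cont a_cont)
  have W_int: "W x = (8 * of_real pi * (k - K)) * integral {0..x} h" if x: "x \<in> {0<..<1}" for x
  proof -
    have d: "a differentiable_on {0..x}" "a1 differentiable_on {0..x}" "b differentiable_on {0..x}"
      "b1 differentiable_on {0..x}"
      using x unfolding differentiable_on_def
      by (auto intro!: differentiable_at_withinI differentiableI_vector[OF a1]
          differentiableI_vector[OF a2] differentiableI_vector[OF b1] differentiableI_vector[OF b2])
    have "continuous_on {0..x} W"
      unfolding W_def[abs_def] by (intro continuous_intros d[THEN differentiable_imp_continuous_on])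
    then have "((\<lambda>r. (8 * of_real pi * (k - K)) * h r) has_integral (W x - W 0)) {0..x}"
      using x by (intro fundamental_theorem_of_calculus_interior W_deriv) auto
    moreover have "((\<lambda>r. (8 * of_real pi * (k - K)) * h r) has_integral
        (8 * of_real pi * (k - K)) * integral {0..x} h) {0..x}"
      using x by (intro has_integral_mult_right integrable_integral integrable_continuous_interval
          continuous_on_subset[OF h_cont]) auto
    ultimately show ?thesis by (simp add: W_def has_integral_unique)
  qed
  define J where "J = integral {0..1} h"
  have "((\<lambda>x. integral {0..x} h) \<longlongrightarrow> J) (at_left 1)"
    unfolding J_def
    by (rule continuous_on_Icc_at_leftD[OF indefinite_integral_continuous_1])
       (auto intro: integrable_continuous_interval h_cont)
  then have "((\<lambda>x. (8 * of_real pi * (k - K)) * integral {0..x} h) \<longlongrightarrow> (8 * of_real pi * (k - K)) * J) (at_left 1)"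
    by (intro tendsto_intros)
  moreover have near: "\<forall>\<^sub>F x::real in at_left 1. x \<in> {0<..<1}"
    by (rule eventually_at_left_real) simp
  ultimately have W_lim: "(W \<longlongrightarrow> (8 * of_real pi * (k - K)) * J) (at_left 1)"
    using W_int by (auto elim!: Lim_transform_eventually eventually_mono)
  \<comment> \<open>The derivative of \<open>g * a\<close>; dividing the definition of \<open>W\<close> by \<open>2 * pi * r * (1 + r)\<close> expresses
    \<open>(1 - r) * v' r\<close> by \<open>W\<close> and quantities that have limits.\<close>
  define v' where "v' r = g r * a1 r + g1 r * a r" for r
  have "- 2 * (k - K) * J = 0"
  proof (rule no_logarithmic_growth)
    show "((\<lambda>r. g r * a r) \<longlongrightarrow> g 1 * 0) (at_left 1)" by (intro tendsto_intros g_lim a_lim)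
    show "\<forall>\<^sub>F r in at_left 1. ((\<lambda>r. g r * a r) has_vector_derivative v' r) (at r)"
      using near unfolding v'_def by eventually_elim (auto intro!: has_vector_derivative_mult g1 a1)
    have "((\<lambda>r. (of_real r * a r * (2 * of_real pi * ((1 - of_real r ^ 2) * g1 r - 2 * of_real r * g r)) - W r)
          / (2 * of_real pi * of_real r * (1 + of_real r)) + (1 - of_real r) * g1 r * a r)
        \<longlongrightarrow> (of_real 1 * 0 * (2 * of_real pi * ((1 - of_real 1 ^ 2) * g1 1 - 2 * of_real 1 * g 1))
            - (8 * of_real pi * (k - K)) * J)
          / (2 * of_real pi * of_real 1 * (1 + of_real 1)) + (1 - of_real 1) * g1 1 * 0) (at_left 1)"
      by (intro tendsto_intros g_lim a_lim W_lim) auto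
    moreover have "(of_real 1 * 0 * (2 * of_real pi * ((1 - of_real 1 ^ 2) * g1 1 - 2 * of_real 1 * g 1))
            - (8 * of_real pi * (k - K)) * J)
          / (2 * of_real pi * of_real 1 * (1 + of_real 1)) + (1 - of_real 1) * g1 1 * 0 = - 2 * (k - K) * J"
      by (simp add: field_simps)
    ultimately have "((\<lambda>r. (of_real r * a r * (2 * of_real pi * ((1 - of_real r ^ 2) * g1 r - 2 * of_real r * g r)) - W r)
          / (2 * of_real pi * of_real r * (1 + of_real r)) + (1 - of_real r) * g1 r * a r)
        \<longlongrightarrow> - 2 * (k - K) * J) (at_left 1)"
      by (simp only:)
    moreover have "\<forall>\<^sub>F r in at_left 1.
       (of_real r * a r * (2 * of_real pi * ((1 - of_real r ^ 2) * g1 r - 2 * of_real r * g r)) - W r)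
          / (2 * of_real pi * of_real r * (1 + of_real r)) + (1 - of_real r) * g1 r * a r
        = (1 - of_real r) * v' r"
      using near
    proof eventually_elim
      case (elim r)
      let ?R = "complex_of_real r"
      have r': "r \<in> {-1<..<1}" using elim by auto
      have br: "b r = 2 * of_real pi * ((1 - ?R\<^sup>2) * g r)" using elim by (intro b) auto
      have nz: "?R \<noteq> 0" "1 + ?R \<noteq> 0" using elim by (auto simp: complex_eq_iff)
      have "?R * a r * (2 * of_real pi * ((1 - ?R ^ 2) * g1 r - 2 * ?R * g r)) - W r
          = 2 * of_real pi * ?R * (1 + ?R) * ((1 - ?R) * (g r * a1 r))"
        unfolding W_def b1_eq[OF r'] br by (simp add: algebra_simps power2_eq_square)
      then have "(?R * a r * (2 * of_real pi * ((1 - ?R ^ 2) * g1 r - 2 * ?R * g r)) - W r)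
          / (2 * of_real pi * ?R * (1 + ?R)) = (1 - ?R) * (g r * a1 r)"
        using nz by (simp only: nonzero_mult_div_cancel_left mult_eq_0_iff de_Morgan_disj) simp
      then show ?case by (simp only: v'_def) (simp add: algebra_simps)
    qed
    ultimately show "((\<lambda>r. (1 - of_real r) * v' r) \<longlongrightarrow> - 2 * (k - K) * J) (at_left 1)"
      by (rule Lim_transform_eventually)
  qed
  moreover have "disk_integral (\<lambda>z. f z * cnj (scat_core p q z)) = J"
    unfolding disk_integral_scat_core J_def h_def[abs_def] g_def a_def n_def ..
  ultimately show ?thesis by (auto simp: K_def)
qed

section \<open>The eigenspaces\<close>

lemma dirichlet_ker_lincomb:
  assumes "f \<in> dirichlet_ker k" "g \<in> dirichlet_ker k"
  shows "(\<lambda>z. c * f z + g z) \<in> dirichlet_ker k"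
proof -
  have f: "on_closed_disk f = f" "continuous_on (cball 0 1) f" "C2_on (ball 0 1) f"
      "\<forall>z\<in>sphere 0 1. f z = 0" "\<forall>z\<in>ball 0 1. laplace_tilde f z + k * f z = 0"
    and g: "on_closed_disk g = g" "continuous_on (cball 0 1) g" "C2_on (ball 0 1) g"
      "\<forall>z\<in>sphere 0 1. g z = 0" "\<forall>z\<in>ball 0 1. laplace_tilde g z + k * g z = 0"
    using assms by (auto simp: dirichlet_ker_def dirichlet_functions_def)
  have "f z = 0" "g z = 0" if "z \<notin> cball 0 1" for z
    using that fun_cong[OF f(1), of z] fun_cong[OF g(1), of z] by (simp_all add: on_closed_disk_def)
  then have "on_closed_disk (\<lambda>z. c * f z + g z) = (\<lambda>z. c * f z + g z)"
    by (auto simp: on_closed_disk_def fun_eq_iff)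
  moreover have "laplace_tilde (\<lambda>z. c * f z + g z) z + k * (c * f z + g z) = 0" if z: "z \<in> ball 0 1" for z
  proof -
    have "laplace_tilde (\<lambda>z. c * f z + g z) z + k * (c * f z + g z)
      = c * (laplace_tilde f z + k * f z) + (laplace_tilde g z + k * g z)"
      unfolding laplace_tilde_lincomb[OF f(3) g(3) open_ball z] by (simp add: algebra_simps)
    then show ?thesis using f(5) g(5) z by simp
  qed
  ultimately show ?thesis
    using f g unfolding dirichlet_ker_def dirichlet_functions_def
    by (auto intro!: continuous_intros C2_on_lincomb)
qed

lemma dirichlet_ker_0: "(\<lambda>z. 0) \<in> dirichlet_ker k"
proof -
  have "zpoly {} (\<lambda>_::unit. 0) (\<lambda>_. 0) (\<lambda>_. 0) = (\<lambda>z. 0)" by (simp add: zpoly_def)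
  then have "C2_on (ball 0 1) (\<lambda>z. 0)" "laplace_tilde (\<lambda>z. 0) z = 0" for z
    using C2_on_zpoly[OF open_ball, of 0 1 "{}" "\<lambda>_::unit. 0" "\<lambda>_. 0" "\<lambda>_. 0"]
      laplace_tilde_zpoly[of "{}" "\<lambda>_::unit. 0" "\<lambda>_. 0" "\<lambda>_. 0" z]
    by (simp_all add: zpoly_def)
  then show ?thesis
    by (simp add: dirichlet_ker_def dirichlet_functions_def on_closed_disk_def fun_eq_iff)
qed

lemma dirichlet_ker_subspace: "cfun.subspace (dirichlet_ker k)"
proof -
  have "f + g \<in> dirichlet_ker k" if "f \<in> dirichlet_ker k" "g \<in> dirichlet_ker k" for f g
    using dirichlet_ker_lincomb[OF that, of 1] by (simp add: plus_fun_def)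
  moreover have "cfun_scale c f \<in> dirichlet_ker k" if "f \<in> dirichlet_ker k" for c f
    using dirichlet_ker_lincomb[OF that dirichlet_ker_0, of c] by (simp add: cfun_scale_def)
  moreover have "0 \<in> dirichlet_ker k" using dirichlet_ker_0 by (simp add: zero_fun_def)
  ultimately show ?thesis by (simp add: cfun.subspace_def)
qed

definition scat_fun :: "nat \<times> nat \<Rightarrow> complex \<Rightarrow> complex" where
  "scat_fun x = on_closed_disk (scattering_poly (fst x) (snd x))"

text \<open>The pairing of a function with the scattering polynomial indexed by \<open>x\<close>, in the inner product with
weight \<open>1 / (1 - z * cnj z)\<close>, for which the operator is formally self-adjoint.\<close>

definition scat_pairing :: "(complex \<Rightarrow> complex) \<Rightarrow> nat \<times> nat \<Rightarrow> complex" where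
  "scat_pairing f x = disk_integral (\<lambda>z. f z * cnj (scat_core (fst x) (snd x) z))"

definition factorizations :: "complex \<Rightarrow> (nat \<times> nat) set" where
  "factorizations k = {(p, q). p > 0 \<and> q > 0 \<and> of_nat (p * q) = k}"

lemma scat_pairing_lincomb:
  assumes f: "continuous_on (cball 0 1) f" and A: "finite A"
  shows "scat_pairing (\<lambda>z. f z + (\<Sum>x\<in>A. c x * scat_fun x z)) y =
    scat_pairing f y + (\<Sum>x\<in>A. c x * scat_pairing (scat_fun x) y)"
proof -
  let ?G = "\<lambda>z. cnj (scat_core (fst y) (snd y) z)"
  have G: "continuous_on (cball 0 1) ?G" by (intro continuous_intros continuous_on_scat_core)
  have s: "continuous_on (cball 0 1) (scat_fun x)" for x
    unfolding scat_fun_def by (rule continuous_on_scattering_poly)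
  have "scat_pairing (\<lambda>z. f z + (\<Sum>x\<in>A. c x * scat_fun x z)) y
    = disk_integral (\<lambda>z. 1 * (f z * ?G z) + (\<Sum>x\<in>A. c x * (scat_fun x z * ?G z)))"
    by (simp add: scat_pairing_def distrib_right sum_distrib_right mult.assoc)
  also have "\<dots> = 1 * disk_integral (\<lambda>z. f z * ?G z) + disk_integral (\<lambda>z. \<Sum>x\<in>A. c x * (scat_fun x z * ?G z))"
    by (rule disk_integral_lincomb) (intro continuous_intros f G s)+
  also have "disk_integral (\<lambda>z. \<Sum>x\<in>A. c x * (scat_fun x z * ?G z))
      = (\<Sum>x\<in>A. c x * disk_integral (\<lambda>z. scat_fun x z * ?G z))"
    by (rule disk_integral_sum[OF A]) (intro continuous_intros G s)
  finally show ?thesis by (simp add: scat_pairing_def)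
qed

lemma scat_pairing_complete:
  assumes "continuous_on (cball 0 1) f"
    and "\<And>p q. p > 0 \<Longrightarrow> q > 0 \<Longrightarrow> scat_pairing f (p, q) = 0" and "z \<in> cball 0 1"
  shows "f z = 0"
  using scat_core_complete[OF assms(1) _ assms(3)] assms(2) by (simp add: scat_pairing_def)

lemma scat_pairing_dirichlet_ker:
  assumes "f \<in> dirichlet_ker k" "p > 0" "q > 0" "of_nat (p * q) \<noteq> k"
  shows "scat_pairing f (p, q) = 0"
  using eigenfunction_scat_core_orthogonal[OF assms(1-3)] assms(4) by (auto simp: scat_pairing_def)

text \<open>The eigenvalue \<open>p * q\<close> and the Fourier mode \<open>q - p\<close> together single out one scattering polynomial.\<close>

lemma product_difference_unique:
  fixes p q p' q' :: nat
  assumes "p * q = p' * q'" "int q - int p = int q' - int p'" "p > 0" "q > 0"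
  shows "p = p' \<and> q = q'"
proof -
  \<comment> \<open>With equal differences, a smaller first factor forces a smaller second factor.\<close>
  have less: False if "a * b = c * d" "b + c = d + a" "a < c" "c > 0" "d > 0" for a b c d :: nat
  proof -
    have "b < d" using that by linarith
    then have "a * b < c * d" using that by (intro mult_strict_mono) auto
    then show False using that by simp
  qed
  have "p' > 0" "q' > 0" using assms by (auto intro: gr0I)
  moreover have "q + p' = q' + p" using assms(2) by linarith
  ultimately show ?thesis
    using less[of p q p' q'] less[of p' q' p q] assms by (cases p p' rule: linorder_cases) auto
qed

text \<open>Different eigenvalues are separated by Green's formula; equal eigenvalues force different Fourier
modes, which are orthogonal on every circle.\<close>

lemma scat_pairing_orthogonal:
  assumes "p > 0" "q > 0" "p' > 0" "q' > 0" "(p, q) \<noteq> (p', q')"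
  shows "scat_pairing (scat_fun (p, q)) (p', q') = 0"
proof (cases "p * q = p' * q'")
  case False
  then have "complex_of_nat (p' * q') \<noteq> of_nat (p * q)" by (metis of_nat_eq_iff)
  then show ?thesis
    using scattering_poly_in_ker[OF assms(1,2)] assms(3,4)
    by (intro scat_pairing_dirichlet_ker) (auto simp: scat_fun_def)
next
  case True
  then have ne: "int q' - int p' \<noteq> int q - int p"
    using product_difference_unique[of p q p' q'] assms by auto
  have "integral {0..1} (\<lambda>r. of_real r * (scat_core p' q' (of_real r) *
      fourier_mode (int q' - int p') (on_closed_disk (scattering_poly p q)) r)) = integral {0..1} (\<lambda>r::real. 0 :: complex)"
    by (rule integral_cong) (use ne in \<open>simp add: fourier_mode_scattering_poly\<close>)
  then show ?thesis by (simp add: scat_pairing_def scat_fun_def disk_integral_scat_core)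
qed

text \<open>On the real axis, multiplication by \<open>r ^ (p + q)\<close> turns \<open>scat_core p q\<close> into a polynomial in \<open>r ^ 2\<close>
with the same coefficients, and that polynomial has finitely many roots.\<close>

lemma scat_core_not_identically_0:
  assumes "p > 0" "q > 0"
  obtains r where "r \<in> {0<..<1}" "scat_core p q (of_real r) \<noteq> 0"
proof -
  let ?N = "p + q - 1" and ?c = "\<lambda>m. complex_of_real (scat_coeff p q m)"
  have pow: "of_real r ^ (p + q) * scat_core p q (of_real r) = (\<Sum>m\<le>?N. ?c m * (of_real (r\<^sup>2)) ^ m)" for r
  proof -
    have "of_real r ^ (p + q) * (?c m * of_real r ^ (m - p) * cnj (of_real r) ^ (m - q)) =
        ?c m * (of_real (r\<^sup>2)) ^ m" for m
    proof (cases "m < p \<or> m < q")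
      case False
      then have "p + q + (m - p) + (m - q) = 2 * m" by auto
      then have "complex_of_real r ^ (p + q) * of_real r ^ (m - p) * of_real r ^ (m - q) = of_real r ^ (2 * m)"
        by (metis power_add)
      moreover have "of_real r ^ (2 * m) = (complex_of_real (r\<^sup>2)) ^ m"
        by (simp add: power_mult)
      ultimately show ?thesis by (simp only: complex_cnj_complex_of_real mult_ac)
    qed (simp add: scat_coeff_eq_0)
    then show ?thesis by (simp only: scat_core_def zpoly_def sum_distrib_left)
  qed
  have "finite {z. (\<Sum>m\<le>?N. ?c m * z ^ m) = 0}"
    using polyfun_rootbound[of ?N ?c] scat_coeff_top[OF assms] by auto
  moreover have "infinite (complex_of_real ` {0<..<1})"
    by (subst finite_image_iff) (auto simp: inj_on_def infinite_Ioo)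
  ultimately have "\<not> complex_of_real ` {0<..<1} \<subseteq> {z. (\<Sum>m\<le>?N. ?c m * z ^ m) = 0}"
    using finite_subset by blast
  then obtain x where "x \<in> {0<..<1}" and x3: "(\<Sum>m\<le>?N. ?c m * (of_real x) ^ m) \<noteq> 0"
    by blast
  then have x: "0 < x" "x < 1" by auto
  have "of_real (sqrt x) ^ (p + q) * scat_core p q (of_real (sqrt x)) \<noteq> 0"
    unfolding pow using x x3 by simp
  then have "scat_core p q (of_real (sqrt x)) \<noteq> 0" by auto
  then show ?thesis using x by (intro that[of "sqrt x"]) auto
qed

text \<open>If this pairing were \<open>0\<close>, the scattering polynomial would be orthogonal to all scattering polynomials,
hence \<open>0\<close> by completeness. This replaces an evaluation of the norm.\<close>

lemma scat_pairing_self: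
  assumes "p > 0" "q > 0"
  shows "scat_pairing (scat_fun (p, q)) (p, q) \<noteq> 0"
proof
  assume "scat_pairing (scat_fun (p, q)) (p, q) = 0"
  then have "scat_pairing (scat_fun (p, q)) (p', q') = 0" if "p' > 0" "q' > 0" for p' q'
    using scat_pairing_orthogonal[OF assms that] by (cases "(p, q) = (p', q')") auto
  moreover have "continuous_on (cball 0 1) (scat_fun (p, q))"
    by (simp add: scat_fun_def continuous_on_scattering_poly)
  ultimately have zero: "scat_fun (p, q) z = 0" if "z \<in> cball 0 1" for z
    using scat_pairing_complete that by blast
  obtain r where r: "r \<in> {0<..<1}" "scat_core p q (of_real r) \<noteq> 0"
    using scat_core_not_identically_0[OF assms] .
  then have "(1 - complex_of_real r * of_real r) * scat_core p q (of_real r) = 0"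
    using zero[of "of_real r"] by (simp add: scat_fun_def on_closed_disk_scattering_poly)
  moreover have "r\<^sup>2 \<noteq> 1" using r(1) by (auto simp: power2_eq_1_iff)
  then have "1 - complex_of_real r * of_real r \<noteq> 0"
    by (simp add: power2_eq_square flip: of_real_mult)
  ultimately show False using r by simp
qed

lemma factorizations_of_nat:
  "factorizations (of_nat k) = {(p, q). p > 0 \<and> q > 0 \<and> p * q = k}"
  unfolding factorizations_def of_nat_eq_iff ..

lemma finite_factorizations: "finite (factorizations k)"
proof (cases "\<exists>m. k = of_nat m")
  case True
  then obtain m where m: "k = of_nat m" by auto
  have "factorizations k \<subseteq> {..m} \<times> {..m}"
    by (auto simp: m factorizations_of_nat)
  then show ?thesis by (rule finite_subset) auto
next
  case False
  then have "factorizations k = {}" by (auto simp: factorizations_def simp del: of_nat_mult)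
  then show ?thesis by simp
qed

text \<open>The eigenfunction minus its orthogonal projection to the scattering polynomials of the same eigenvalue
is orthogonal to all scattering polynomials, so it is \<open>0\<close> by completeness. If \<open>k\<close> is not
a positive integer, the sum is empty.\<close>

lemma dirichlet_ker_expansion:
  assumes f: "f \<in> dirichlet_ker k"
  obtains c where "f = (\<lambda>z. \<Sum>x\<in>factorizations k. c x * scat_fun x z)"
proof
  define c where "c x = scat_pairing f x / scat_pairing (scat_fun x) x" for x
  let ?S = "factorizations k"
  let ?g = "\<lambda>z. f z + (\<Sum>x\<in>?S. - c x * scat_fun x z)"
  have fcont: "continuous_on (cball 0 1) f" and fext: "on_closed_disk f = f"
    using f by (auto simp: dirichlet_ker_def dirichlet_functions_def)
  have orth: "scat_pairing ?g (p, q) = 0" if pq: "p > 0" "q > 0" for p q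
  proof -
    have "(\<Sum>x\<in>?S. - c x * scat_pairing (scat_fun x) (p, q)) =
        (\<Sum>x\<in>?S. if x = (p, q) then - scat_pairing f (p, q) else 0)"
      using scat_pairing_orthogonal[OF _ _ pq] scat_pairing_self[OF pq]
      by (intro sum.cong) (auto simp: factorizations_def c_def)
    then have "scat_pairing ?g (p, q) = scat_pairing f (p, q) - (if (p, q) \<in> ?S then scat_pairing f (p, q) else 0)"
      unfolding scat_pairing_lincomb[OF fcont finite_factorizations] by (simp add: finite_factorizations)
    then show ?thesis
      using scat_pairing_dirichlet_ker[OF f pq] pq by (auto simp: factorizations_def)
  qed
  have cont: "continuous_on (cball 0 1) ?g"
    by (intro continuous_intros fcont) (simp add: scat_fun_def continuous_on_scattering_poly)
  have zero: "?g z = 0" if "z \<in> cball 0 1" for z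
    using scat_pairing_complete[OF cont orth that] .
  show "f = (\<lambda>z. \<Sum>x\<in>?S. c x * scat_fun x z)"
  proof
    fix z show "f z = (\<Sum>x\<in>?S. c x * scat_fun x z)"
    proof (cases "z \<in> cball 0 1")
      case True
      then show ?thesis using zero[of z] by (simp add: sum_negf)
    next
      case False
      then have "f z = 0" "scat_fun x z = 0" for x
        using fun_cong[OF fext, of z] by (auto simp: on_closed_disk_def scat_fun_def)
      then show ?thesis by simp
    qed
  qed
qed

lemma sum_functions_apply: "(\<Sum>x\<in>A. F x) z = (\<Sum>x\<in>A. F x z)"
  for F :: "'a \<Rightarrow> 'b \<Rightarrow> 'c::comm_monoid_add"
  by (induction A rule: infinite_finite_induct) auto

lemma dirichlet_ker_span: "dirichlet_ker k = cfun.span (scat_fun ` factorizations k)"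
proof
  show "dirichlet_ker k \<subseteq> cfun.span (scat_fun ` factorizations k)"
  proof
    fix f assume "f \<in> dirichlet_ker k"
    then obtain c where "f = (\<lambda>z. \<Sum>x\<in>factorizations k. c x * scat_fun x z)"
      by (rule dirichlet_ker_expansion)
    then have f: "f = (\<Sum>x\<in>factorizations k. cfun_scale (c x) (scat_fun x))"
      by (simp add: fun_eq_iff sum_functions_apply cfun_scale_def)
    show "f \<in> cfun.span (scat_fun ` factorizations k)"
      unfolding f by (intro cfun.span_sum cfun.span_scale cfun.span_base imageI)
  qed
  show "cfun.span (scat_fun ` factorizations k) \<subseteq> dirichlet_ker k"
    by (rule cfun.span_minimal[OF _ dirichlet_ker_subspace])
       (auto simp: factorizations_def scat_fun_def simp del: of_nat_mult intro: scattering_poly_in_ker)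
qed

lemma scat_fun_inj: "inj_on scat_fun (factorizations k)"
proof (rule inj_onI, rule ccontr)
  fix x y assume "x \<in> factorizations k" "y \<in> factorizations k" "scat_fun x = scat_fun y" "x \<noteq> y"
  then show False
    using scat_pairing_self[of "fst x" "snd x"] scat_pairing_orthogonal[of "fst y" "snd y" "fst x" "snd x"]
    by (auto simp: factorizations_def)
qed

lemma scat_fun_independent: "cfun.independent (scat_fun ` factorizations k)"
proof (rule cfun.independent_if_scalars_zero)
  let ?S = "factorizations k"
  show "finite (scat_fun ` ?S)" by (simp add: finite_factorizations)
  fix u v assume sum0: "(\<Sum>v\<in>scat_fun ` ?S. cfun_scale (u v) v) = 0" and "v \<in> scat_fun ` ?S"
  then obtain y where y: "y \<in> ?S" "v = scat_fun y" by auto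
  have "(\<Sum>x\<in>?S. u (scat_fun x) * scat_fun x z) = 0" for z
    using fun_cong[OF sum0, of z]
    by (simp add: sum.reindex[OF scat_fun_inj] sum_functions_apply cfun_scale_def)
  then have "scat_pairing (\<lambda>z. 0 + (\<Sum>x\<in>?S. u (scat_fun x) * scat_fun x z)) y = 0"
    by (simp add: scat_pairing_def)
  then have "(\<Sum>x\<in>?S. u (scat_fun x) * scat_pairing (scat_fun x) y) = 0"
    by (subst (asm) scat_pairing_lincomb) (auto simp: finite_factorizations scat_pairing_def)
  also have "(\<Sum>x\<in>?S. u (scat_fun x) * scat_pairing (scat_fun x) y) =
      (\<Sum>x\<in>?S. if x = y then u (scat_fun y) * scat_pairing (scat_fun y) y else 0)"
    using y(1) scat_pairing_orthogonal
    by (intro sum.cong) (auto simp: factorizations_def)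
  finally have "u (scat_fun y) * scat_pairing (scat_fun y) y = 0"
    using y(1) by (simp add: finite_factorizations)
  moreover have "scat_pairing (scat_fun y) y \<noteq> 0"
    using scat_pairing_self[of "fst y" "snd y"] y(1) by (auto simp: factorizations_def)
  ultimately show "u v = 0" by (simp add: y(2))
qed

lemma card_factorizations:
  assumes "k > 0"
  shows "card (factorizations (of_nat k)) = card {d. d dvd k}"
proof (rule bij_betw_same_card)
  show "bij_betw fst (factorizations (of_nat k)) {d. d dvd k}"
    unfolding bij_betw_def factorizations_of_nat
  proof
    show "inj_on fst {(p, q). p > 0 \<and> q > 0 \<and> p * q = k}"
      by (auto simp: inj_on_def)
    have "d \<in> fst ` {(p, q). p > 0 \<and> q > 0 \<and> p * q = k}" if "d dvd k" for d
      using that assms by (intro image_eqI[of _ _ "(d, k div d)"]) (auto intro!: Nat.gr0I)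
    then show "fst ` {(p, q). p > 0 \<and> q > 0 \<and> p * q = k} = {d. d dvd k}"
      by auto
  qed
qed

theorem theorem3p1:
  "(\<forall>k::complex. dirichlet_eigenvalue k \<and> k \<noteq> 0 \<longrightarrow> (\<exists>n::nat. n > 0 \<and> k = of_nat n)) \<and>
   (\<forall>k::nat. k > 0 \<longrightarrow>
      dirichlet_ker (of_nat k) =
        cfun.span {on_closed_disk (scattering_poly p q) | p q. p > 0 \<and> q > 0 \<and> p * q = k} \<and>
      cfun.dim (dirichlet_ker (of_nat k)) = card {d::nat. d dvd k})"
proof (intro conjI allI impI; (elim conjE)?)
  fix k assume "dirichlet_eigenvalue k"
  then obtain f where f: "f \<in> dirichlet_functions" "f \<noteq> 0"
    and eq: "\<And>z. z \<in> ball 0 1 \<Longrightarrow> - laplace_tilde f z = k * f z"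
    unfolding dirichlet_eigenvalue_def dirichlet_eigenfunction_def by blast
  have "laplace_tilde f z + k * f z = 0" if "z \<in> ball 0 1" for z
    unfolding eq[OF that, symmetric] by simp
  then have "f \<in> dirichlet_ker k"
    using f(1) by (simp add: dirichlet_ker_def)
  then obtain c where "f = (\<lambda>z. \<Sum>x\<in>factorizations k. c x * scat_fun x z)"
    by (rule dirichlet_ker_expansion)
  then have "factorizations k \<noteq> {}"
    using f(2) by (auto simp: zero_fun_def)
  then obtain p q where "p > 0" "q > 0" "k = of_nat (p * q)" by (auto simp: factorizations_def)
  then show "\<exists>n>0. k = of_nat n" by (intro exI[of _ "p * q"]) simp
next
  fix k :: nat assume k: "k > 0"
  have "{on_closed_disk (scattering_poly p q) | p q. p > 0 \<and> q > 0 \<and> p * q = k} = scat_fun ` factorizations (of_nat k)"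
    by (auto simp: factorizations_of_nat scat_fun_def image_iff; blast)
  then show "dirichlet_ker (of_nat k) =
      cfun.span {on_closed_disk (scattering_poly p q) | p q. p > 0 \<and> q > 0 \<and> p * q = k}"
    by (simp add: dirichlet_ker_span)
  have "cfun.dim (dirichlet_ker (of_nat k)) = card (scat_fun ` factorizations (of_nat k))"
    unfolding dirichlet_ker_span by (rule cfun.dim_span_eq_card_independent[OF scat_fun_independent])
  then show "cfun.dim (dirichlet_ker (of_nat k)) = card {d. d dvd k}"
    by (simp add: card_image[OF scat_fun_inj] card_factorizations[OF k])
qed

end
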